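(* Let $A=(A_1,\ldots,A_s)\in\mathbb{R}^{m\times n}$, with $A_k\in\mathbb{R}^{m\times p}$ and $n=sp\le m$, be of full column rank, and let $\hat A_k=(A_1,\ldots,A_k)$. Let $\hat Q_k$ and $R_k$ be the matrices computed by $k$ steps of the algorithm BCGS2 in floating point arithmetic with machine unit $\varepsilon_M$ (see context), and let $t_k=kp$. Then for $k=1,\ldots,s$, $$\|\hat A_k-\hat Q_kR_k\|_2\le \varepsilon_M\, f_2(m,t_{k-1},p)\,\|\hat A_k\|_2+\mathcal{O}(\varepsilon_M^2),$$ where $$f_2(m,t_{k-1},p)=k^{1/2}f_{resid}(m,t_{k-1},p),\qquad f_{resid}(m,t,p)=2L_1(m,p)+2L_3(t,p)+L_4(p)+L_5(p).$$ Consequently (taking $k=s$, $Q=\hat Q_s$, $R=R_s$), $\|A-QR\|_2\le\varepsilon_M f_2(m,t_{s-1},p)\|A\|_2+\mathcal{O}(\varepsilon_M^2)$.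
   Context: $\mathcal{O}(\varepsilon_M^j)$ denotes a quantity bounded by $C\varepsilon_M^j$ for all sufficiently small $\varepsilon_M>0$, with $C$ independent of $\varepsilon_M$ (it may depend on the dimensions and the input matrices). $L_1(m,p),L_2(m,t,p),L_3(t,p),L_4(p),L_5(p),f_1(m,t,p)$ are fixed positive ("modestly growing") functions, nondecreasing in all their arguments. Routine local_qr: for $B\in\mathbb{R}^{m\times p}$, $p\le m$, the computed output $[Q,R]=\mathrm{local\_qr}(B)$ consists of $Q\in\mathbb{R}^{m\times p}$ and upper triangular $R\in\mathbb{R}^{p\times p}$ with $\|I_p-Q^TQ\|_2\le\varepsilon_ML_1(m,p)<1$ and $\|B-QR\|_2\le\varepsilon_ML_1(m,p)\|B\|_2$. Routine block_CGS_step$(U,B)$, for $U\in\mathbb{R}^{m\times t}$, $B\in\mathbb{R}^{m\times p}$, $t+p\le n\le m$: compute $\bar S=U^TB$; $\bar Y=B-U\bar S$; $[\bar Q,\bar R]=\mathrm{local\_qr}(\bar Y)$; return $\bar Q,\bar R,\bar S$. In floating point arithmetic the computed quantities satisfy $\|I_p-\bar Q^T\bar Q\|_2\le\varepsilon_ML_1(m,p)$; $\bar Q\bar R=\bar Y+\Delta\bar Y$, $\|\Delta\bar Y\|_2\le\varepsilon_ML_1(m,p)\|B\|_2$; $\bar S+\delta\bar S=U^TB$, $\|\delta\bar S\|_2\le\varepsilon_ML_2(m,t,p)\|B\|_2+\mathcal{O}(\varepsilon_M^2)$; $\bar Y+\delta\bar Y=B-U\bar S$, $\|\delta\bar Y\|_2\le\varepsilon_ML_3(t,p)\|B\|_2+\mathcal{O}(\varepsilon_M^2)$.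 Routine block_CGS2_step$(U,B)$: $[Q_1',R_1',S_1']=\mathrm{block\_CGS\_step}(U,B)$; $[Q_B,R_2',S_2']=\mathrm{block\_CGS\_step}(U,Q_1')$; $S_B=S_1'+S_2'R_1'$; $R_B=R_2'R_1'$; return $Q_B,R_B,S_B$. The computed $S_B,R_B$ satisfy $S_B+\delta S_B=S_1'+S_2'R_1'$, $\|\delta S_B\|_2\le\varepsilon_ML_4(p)\|B\|_2$, and $R_B+\delta R_B=R_2'R_1'$, $\|\delta R_B\|_2\le\varepsilon_ML_5(p)\|B\|_2$. Algorithm BCGS2: $[Q_1,R_{11}]=\mathrm{local\_qr}(A_1)$, $\hat Q_1=Q_1$, $R_1=R_{11}$. For $k=1,\ldots,s-1$: $[Q_{k+1},R_{k+1,k+1},S_{k+1}]=\mathrm{block\_CGS2\_step}(\hat Q_k,A_{k+1})$, $\hat Q_{k+1}=(\hat Q_k,\,Q_{k+1})$, $R_{k+1}=\begin{pmatrix}R_k&S_{k+1}\\0&R_{k+1,k+1}\end{pmatrix}$. Standing assumption: each matrix $U=\hat Q_k$ ($1\le k\le s-1$) passed to block_CGS2_step is near left orthogonal, i.e. $\|I_{t_k}-\hat Q_k^T\hat Q_k\|_2\le\varepsilon_Mf_1(m,t_k,p)+\mathcal{O}(\varepsilon_M^2)<1$, with $\varepsilon_Mf_1(m,t_k,p)<1$. *)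

theory Defs
  imports
    "Jordan_Normal_Form.Matrix"
    "Jordan_Normal_Form.DL_Rank"
    "HOL-Analysis.L2_Norm"
    "HOL-Library.Landau_Symbols"
begin

section \<open>Spectral norm and block matrices\<close>

definition vnorm2 :: "real vec \<Rightarrow> real" where
  "vnorm2 v = sqrt (v \<bullet> v)"

definition norm2 :: "real mat \<Rightarrow> real" where
  "norm2 A = (SUP v \<in> {v \<in> carrier_vec (dim_col A). vnorm2 v \<le> 1}. vnorm2 (A *\<^sub>v v))"

lemma vnorm2_eq_L2_set: "vnorm2 v = L2_set (\<lambda>i. v $ i) {0..<dim_vec v}"
  by (simp add: vnorm2_def scalar_prod_def L2_set_def power2_eq_square)

text \<open>The supremum defining \<open>norm2\<close> is the least upper bound of a nonempty bounded set
  of reals, so it is not an unspecified value of \<open>Sup\<close>.\<close>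

lemma norm2_bdd_above:
  "bdd_above ((\<lambda>v. vnorm2 (A *\<^sub>v v)) ` {v \<in> carrier_vec (dim_col A). vnorm2 v \<le> 1})"
proof -
  have "vnorm2 (A *\<^sub>v v) \<le> (\<Sum>i<dim_row A. vnorm2 (row A i))"
    if v: "v \<in> carrier_vec (dim_col A)" "vnorm2 v \<le> 1" for v
  proof -
    have nn: "0 \<le> vnorm2 w" for w
      by (simp add: vnorm2_eq_L2_set)
    have "\<bar>row A i \<bullet> v\<bar> \<le> vnorm2 (row A i)" for i
    proof -
      have "\<bar>row A i \<bullet> v\<bar> \<le> (\<Sum>j = 0..<dim_col A. \<bar>row A i $ j\<bar> * \<bar>v $ j\<bar>)"
        using v by (simp add: scalar_prod_def abs_mult[symmetric])
      also have "\<dots> \<le> vnorm2 (row A i) * vnorm2 v"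
        using v L2_set_mult_ineq[of "\<lambda>j. row A i $ j" "\<lambda>j. v $ j" "{0..<dim_col A}"]
        by (simp add: vnorm2_eq_L2_set)
      also have "\<dots> \<le> vnorm2 (row A i)"
        using v nn[of "row A i"] by (simp add: mult_left_le)
      finally show ?thesis .
    qed
    moreover have "vnorm2 (A *\<^sub>v v) \<le> (\<Sum>i\<in>{0..<dim_row A}. \<bar>(A *\<^sub>v v) $ i\<bar>)"
      unfolding vnorm2_eq_L2_set dim_mult_mat_vec by (rule L2_set_le_sum_abs)
    ultimately show ?thesis
      by (auto simp: atLeast0LessThan intro!: sum_mono elim!: order_trans)
  qed
  then show ?thesis
    by (intro bdd_aboveI2) auto
qed

lemma norm2_mult_vec_le_1:
  assumes "v \<in> carrier_vec (dim_col A)" "vnorm2 v \<le> 1"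
  shows "vnorm2 (A *\<^sub>v v) \<le> norm2 A"
  unfolding norm2_def using assms by (intro cSUP_upper norm2_bdd_above) auto

definition hcat :: "real mat \<Rightarrow> real mat \<Rightarrow> real mat" where
  "hcat A B = four_block_mat A B (0\<^sub>m 0 (dim_col A)) (0\<^sub>m 0 (dim_col B))"

text \<open>Column blocks of width \<open>p\<close> are numbered from 1: \<open>A = (A\<^sub>1, \<dots>, A\<^sub>s)\<close>.\<close>

definition col_block :: "nat \<Rightarrow> real mat \<Rightarrow> nat \<Rightarrow> real mat" where
  "col_block p A k = mat (dim_row A) p (\<lambda>(i, j). A $$ (i, (k - 1) * p + j))"

definition leading_blocks :: "nat \<Rightarrow> real mat \<Rightarrow> nat \<Rightarrow> real mat" where
  "leading_blocks p A k = mat (dim_row A) (k * p) (\<lambda>(i, j). A $$ (i, j))"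


section \<open>Asymptotics in the machine unit\<close>

text \<open>Every computed matrix is a family indexed by the machine unit \<open>\<epsilon>\<close>, whereas the input
  matrix does not depend on \<open>\<epsilon>\<close>.  All statements are for sufficiently small \<open>\<epsilon> > 0\<close>;
  \<open>le_upto_eps2 f g\<close> reads \<open>f(\<epsilon>) \<le> g(\<epsilon>) + O(\<epsilon>\<^sup>2)\<close>.\<close>

definition le_upto_eps2 :: "(real \<Rightarrow> real) \<Rightarrow> (real \<Rightarrow> real) \<Rightarrow> bool" where
  "le_upto_eps2 f g \<longleftrightarrow>
     (\<exists>h \<in> O[at_right 0](\<lambda>\<epsilon>. \<epsilon> ^ 2). \<forall>\<^sub>F \<epsilon> in at_right 0. f \<epsilon> \<le> g \<epsilon> + h \<epsilon>)"

text \<open>Positive nondecreasing functions of the dimensions.  The dimensions \<open>m\<close> and \<open>p\<close> are at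
  least 1, while \<open>t\<close> may be 0, because \<open>t\<^sub>0 = 0\<close> occurs in the error bound.\<close>

definition growth_p :: "(nat \<Rightarrow> real) \<Rightarrow> bool" where
  "growth_p f \<longleftrightarrow> (\<forall>p p'. 1 \<le> p \<longrightarrow> p \<le> p' \<longrightarrow> 0 < f p \<and> f p \<le> f p')"

definition growth_mp :: "(nat \<Rightarrow> nat \<Rightarrow> real) \<Rightarrow> bool" where
  "growth_mp f \<longleftrightarrow>
     (\<forall>m m' p p'. 1 \<le> m \<longrightarrow> m \<le> m' \<longrightarrow> 1 \<le> p \<longrightarrow> p \<le> p' \<longrightarrow>
        0 < f m p \<and> f m p \<le> f m' p')"

definition growth_tp :: "(nat \<Rightarrow> nat \<Rightarrow> real) \<Rightarrow> bool" where
  "growth_tp f \<longleftrightarrow>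
     (\<forall>t t' p p'. t \<le> t' \<longrightarrow> 1 \<le> p \<longrightarrow> p \<le> p' \<longrightarrow>
        0 < f t p \<and> f t p \<le> f t' p')"

definition growth_mtp :: "(nat \<Rightarrow> nat \<Rightarrow> nat \<Rightarrow> real) \<Rightarrow> bool" where
  "growth_mtp f \<longleftrightarrow>
     (\<forall>m m' t t' p p'. 1 \<le> m \<longrightarrow> m \<le> m' \<longrightarrow> t \<le> t' \<longrightarrow> 1 \<le> p \<longrightarrow> p \<le> p' \<longrightarrow>
        0 < f m t p \<and> f m t p \<le> f m' t' p')"


section \<open>Computed quantities of the algorithm\<close>

text \<open>Perturbations such as \<open>\<Delta>Y\<close> in \<open>Q R = Y + \<Delta>Y\<close> or \<open>\<delta>S\<close> in \<open>S + \<delta>S = U\<^sup>T B\<close> are uniquely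
  determined by these equations, so they are written as the corresponding differences.

  \<open>qr_factors L1 m p \<epsilon> \<beta> Y Q R\<close> is the error contract of a local QR factorization of \<open>Y\<close> with
  residual measured relative to \<open>\<beta>\<close>: \<open>\<beta>\<close> is the norm of \<open>Y\<close> itself for the stand-alone routine,
  but the norm of the unprojected block \<open>B\<close> inside a block Gram-Schmidt step.\<close>

definition qr_factors ::
  "(nat \<Rightarrow> nat \<Rightarrow> real) \<Rightarrow> nat \<Rightarrow> nat \<Rightarrow> real \<Rightarrow> real \<Rightarrow> real mat \<Rightarrow> real mat \<Rightarrow> real mat \<Rightarrow> bool" where
  "qr_factors L1 m p \<epsilon> \<beta> Y Q R \<longleftrightarrow>
     Q \<in> carrier_mat m p \<and> R \<in> carrier_mat p p \<and> upper_triangular R \<and>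
     norm2 (1\<^sub>m p - Q\<^sup>T * Q) \<le> \<epsilon> * L1 m p \<and> \<epsilon> * L1 m p < 1 \<and>
     norm2 (Q * R - Y) \<le> \<epsilon> * L1 m p * \<beta>"

definition computed_local_qr ::
  "(nat \<Rightarrow> nat \<Rightarrow> real) \<Rightarrow> nat \<Rightarrow> nat \<Rightarrow> (real \<Rightarrow> real mat) \<Rightarrow>
   (real \<Rightarrow> real mat) \<Rightarrow> (real \<Rightarrow> real mat) \<Rightarrow> bool" where
  "computed_local_qr L1 m p B Q R \<longleftrightarrow>
     (\<forall>\<^sub>F \<epsilon> in at_right 0. qr_factors L1 m p \<epsilon> (norm2 (B \<epsilon>)) (B \<epsilon>) (Q \<epsilon>) (R \<epsilon>))"

definition computed_block_CGS_step ::
  "(nat \<Rightarrow> nat \<Rightarrow> real) \<Rightarrow> (nat \<Rightarrow> nat \<Rightarrow> nat \<Rightarrow> real) \<Rightarrow> (nat \<Rightarrow> nat \<Rightarrow> real) \<Rightarrow>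
   nat \<Rightarrow> nat \<Rightarrow> nat \<Rightarrow> (real \<Rightarrow> real mat) \<Rightarrow> (real \<Rightarrow> real mat) \<Rightarrow>
   (real \<Rightarrow> real mat) \<Rightarrow> (real \<Rightarrow> real mat) \<Rightarrow> (real \<Rightarrow> real mat) \<Rightarrow> bool" where
  "computed_block_CGS_step L1 L2 L3 m t p U B Q R S \<longleftrightarrow>
     (\<exists>Y.
        (\<forall>\<^sub>F \<epsilon> in at_right 0. S \<epsilon> \<in> carrier_mat t p \<and> Y \<epsilon> \<in> carrier_mat m p) \<and>
        (\<forall>\<^sub>F \<epsilon> in at_right 0. qr_factors L1 m p \<epsilon> (norm2 (B \<epsilon>)) (Y \<epsilon>) (Q \<epsilon>) (R \<epsilon>)) \<and>
        le_upto_eps2 (\<lambda>\<epsilon>. norm2 ((U \<epsilon>)\<^sup>T * B \<epsilon> - S \<epsilon>))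
                     (\<lambda>\<epsilon>. \<epsilon> * L2 m t p * norm2 (B \<epsilon>)) \<and>
        le_upto_eps2 (\<lambda>\<epsilon>. norm2 ((B \<epsilon> - U \<epsilon> * S \<epsilon>) - Y \<epsilon>))
                     (\<lambda>\<epsilon>. \<epsilon> * L3 t p * norm2 (B \<epsilon>)))"

definition computed_block_CGS2_step ::
  "(nat \<Rightarrow> nat \<Rightarrow> real) \<Rightarrow> (nat \<Rightarrow> nat \<Rightarrow> nat \<Rightarrow> real) \<Rightarrow> (nat \<Rightarrow> nat \<Rightarrow> real) \<Rightarrow>
   (nat \<Rightarrow> real) \<Rightarrow> (nat \<Rightarrow> real) \<Rightarrow>
   nat \<Rightarrow> nat \<Rightarrow> nat \<Rightarrow> (real \<Rightarrow> real mat) \<Rightarrow> (real \<Rightarrow> real mat) \<Rightarrow>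
   (real \<Rightarrow> real mat) \<Rightarrow> (real \<Rightarrow> real mat) \<Rightarrow> (real \<Rightarrow> real mat) \<Rightarrow> bool" where
  "computed_block_CGS2_step L1 L2 L3 L4 L5 m t p U B Q\<^sub>B R\<^sub>B S\<^sub>B \<longleftrightarrow>
     (\<exists>Q1 R1 S1 R2 S2.
        computed_block_CGS_step L1 L2 L3 m t p U B Q1 R1 S1 \<and>
        computed_block_CGS_step L1 L2 L3 m t p U Q1 Q\<^sub>B R2 S2 \<and>
        (\<forall>\<^sub>F \<epsilon> in at_right 0.
           S\<^sub>B \<epsilon> \<in> carrier_mat t p \<and> R\<^sub>B \<epsilon> \<in> carrier_mat p p \<and>
           norm2 ((S1 \<epsilon> + S2 \<epsilon> * R1 \<epsilon>) - S\<^sub>B \<epsilon>) \<le> \<epsilon> * L4 p * norm2 (B \<epsilon>) \<and>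
           norm2 (R2 \<epsilon> * R1 \<epsilon> - R\<^sub>B \<epsilon>) \<le> \<epsilon> * L5 p * norm2 (B \<epsilon>)))"

definition computed_BCGS2 ::
  "(nat \<Rightarrow> nat \<Rightarrow> real) \<Rightarrow> (nat \<Rightarrow> nat \<Rightarrow> nat \<Rightarrow> real) \<Rightarrow> (nat \<Rightarrow> nat \<Rightarrow> real) \<Rightarrow>
   (nat \<Rightarrow> real) \<Rightarrow> (nat \<Rightarrow> real) \<Rightarrow>
   nat \<Rightarrow> nat \<Rightarrow> nat \<Rightarrow> real mat \<Rightarrow> (nat \<Rightarrow> real \<Rightarrow> real mat) \<Rightarrow> (nat \<Rightarrow> real \<Rightarrow> real mat) \<Rightarrow> bool" where
  "computed_BCGS2 L1 L2 L3 L4 L5 m p s A Qhat R \<longleftrightarrow>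
     computed_local_qr L1 m p (\<lambda>_. col_block p A 1) (Qhat 1) (R 1) \<and>
     (\<forall>k \<in> {1..<s}. \<exists>Q' R' S'.
        computed_block_CGS2_step L1 L2 L3 L4 L5 m (k * p) p
          (Qhat k) (\<lambda>_. col_block p A (k + 1)) Q' R' S' \<and>
        (\<forall>\<^sub>F \<epsilon> in at_right 0.
           Qhat (k + 1) \<epsilon> = hcat (Qhat k \<epsilon>) (Q' \<epsilon>) \<and>
           R (k + 1) \<epsilon> = four_block_mat (R k \<epsilon>) (S' \<epsilon>) (0\<^sub>m p (k * p)) (R' \<epsilon>)))"

definition near_left_orthogonal ::
  "(nat \<Rightarrow> nat \<Rightarrow> nat \<Rightarrow> real) \<Rightarrow> nat \<Rightarrow> nat \<Rightarrow> nat \<Rightarrow> (real \<Rightarrow> real mat) \<Rightarrow> bool" where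
  "near_left_orthogonal f1 m t p U \<longleftrightarrow>
     (\<exists>h \<in> O[at_right 0](\<lambda>\<epsilon>. \<epsilon> ^ 2). \<forall>\<^sub>F \<epsilon> in at_right 0.
        norm2 (1\<^sub>m t - (U \<epsilon>)\<^sup>T * U \<epsilon>) \<le> \<epsilon> * f1 m t p + h \<epsilon> \<and>
        \<epsilon> * f1 m t p + h \<epsilon> < 1 \<and> \<epsilon> * f1 m t p < 1)"

definition f_resid ::
  "(nat \<Rightarrow> nat \<Rightarrow> real) \<Rightarrow> (nat \<Rightarrow> nat \<Rightarrow> real) \<Rightarrow> (nat \<Rightarrow> real) \<Rightarrow> (nat \<Rightarrow> real) \<Rightarrow>
   nat \<Rightarrow> nat \<Rightarrow> nat \<Rightarrow> real" where
  "f_resid L1 L3 L4 L5 m t p = 2 * L1 m p + 2 * L3 t p + L4 p + L5 p"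

text \<open>\<open>f2 \<dots> m p k\<close> is the bound usually written \<open>f\<^sub>2(m, t, p)\<close> with \<open>t = (k - 1) p\<close>; the number
  of blocks \<open>k\<close> is passed explicitly because it occurs in the factor \<open>k\<^sup>1\<^sup>/\<^sup>2\<close>.\<close>

definition f2 ::
  "(nat \<Rightarrow> nat \<Rightarrow> real) \<Rightarrow> (nat \<Rightarrow> nat \<Rightarrow> real) \<Rightarrow> (nat \<Rightarrow> real) \<Rightarrow> (nat \<Rightarrow> real) \<Rightarrow>
   nat \<Rightarrow> nat \<Rightarrow> nat \<Rightarrow> real" where
  "f2 L1 L3 L4 L5 m p k = sqrt (real k) * f_resid L1 L3 L4 L5 m ((k - 1) * p) p"

end

theory Submission
  imports Defs
begin

text \<open>Substituting the two block Gram-Schmidt steps into each other expresses the residual of one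
  reorthogonalized step as
  \<open>U \<delta>S + Q \<delta>R + (\<delta>Y\<^sub>2 - \<Delta>Y\<^sub>2) R\<^sub>1 + (\<delta>Y\<^sub>1 - \<Delta>Y\<^sub>1)\<close>, where \<open>Q\<^sub>1, R\<^sub>1\<close> are the factors
  computed by the first step.  Near orthogonality gives
  \<open>\<parallel>U\<parallel>, \<parallel>Q\<parallel>, \<parallel>Q\<^sub>1\<parallel> \<le> 1 + O(\<epsilon>)\<close>, and \<open>I - U U\<^sup>T\<close> does not expand, so \<open>\<parallel>R\<^sub>1\<parallel> \<le> \<parallel>B\<parallel> + O(\<epsilon>)\<close>:
  the step residual is at most \<open>\<epsilon> f_resid \<parallel>B\<parallel> + O(\<epsilon>\<^sup>2)\<close>.  The full residual is the row of the
  \<open>k\<close> step residuals, and the factor \<open>k\<^sup>1\<^sup>/\<^sup>2\<close> comes from \<open>\<parallel>(E, F)\<parallel>\<^sup>2 \<le> \<parallel>E\<parallel>\<^sup>2 + \<parallel>F\<parallel>\<^sup>2\<close>.\<close>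

section \<open>The spectral norm\<close>

lemma vnorm2_nonneg [simp]: "0 \<le> vnorm2 v"
  by (simp add: vnorm2_eq_L2_set)

lemma vnorm2_sq: "vnorm2 v ^ 2 = v \<bullet> v"
  by (simp add: vnorm2_def scalar_prod_def sum_nonneg)

lemma vnorm2_zero [simp]: "vnorm2 (0\<^sub>v n) = 0"
  by (simp add: vnorm2_def)

lemma vnorm2_eq_0: "v \<in> carrier_vec n \<Longrightarrow> vnorm2 v = 0 \<Longrightarrow> v = 0\<^sub>v n"
  by (auto simp: vnorm2_eq_L2_set L2_set_eq_0_iff)

lemma vnorm2_smult: "vnorm2 (c \<cdot>\<^sub>v v) = \<bar>c\<bar> * vnorm2 v"
  by (simp add: vnorm2_def real_sqrt_mult mult.assoc[symmetric])

lemma vnorm2_triangle: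
  assumes "v \<in> carrier_vec n" "w \<in> carrier_vec n"
  shows "vnorm2 (v + w) \<le> vnorm2 v + vnorm2 w"
proof -
  have "L2_set (\<lambda>i. (v + w) $ i) {0..<n} = L2_set (\<lambda>i. v $ i + w $ i) {0..<n}"
    using assms by (intro L2_set_cong) auto
  then show ?thesis
    using assms L2_set_triangle_ineq[of "\<lambda>i. v $ i" "\<lambda>i. w $ i" "{0..<n}"]
    by (simp add: vnorm2_eq_L2_set)
qed

lemma scalar_prod_le_vnorm2:
  assumes "v \<in> carrier_vec n" "w \<in> carrier_vec n"
  shows "\<bar>v \<bullet> w\<bar> \<le> vnorm2 v * vnorm2 w"
proof -
  have "\<bar>v \<bullet> w\<bar> \<le> (\<Sum>i = 0..<n. \<bar>v $ i\<bar> * \<bar>w $ i\<bar>)"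
    using assms by (simp add: scalar_prod_def abs_mult[symmetric])
  also have "\<dots> \<le> vnorm2 v * vnorm2 w"
    using assms L2_set_mult_ineq[of "\<lambda>i. v $ i" "\<lambda>i. w $ i" "{0..<n}"]
    by (simp add: vnorm2_eq_L2_set)
  finally show ?thesis .
qed

lemma vnorm2_append_sq: "vnorm2 (v @\<^sub>v w) ^ 2 = vnorm2 v ^ 2 + vnorm2 w ^ 2"
  unfolding vnorm2_sq
  by (rule scalar_prod_append[of _ "dim_vec v" _ "dim_vec w"]) auto

lemma mult_mat_zero_vec: "A \<in> carrier_mat nr nc \<Longrightarrow> A *\<^sub>v 0\<^sub>v nc = 0\<^sub>v nr"
  by (intro eq_vecI) auto

lemma norm2_nonneg [simp]: "0 \<le> norm2 A"
  using norm2_mult_vec_le_1[of "0\<^sub>v (dim_col A)" A] order_trans[OF vnorm2_nonneg] by auto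

text \<open>Homogeneity: the bound on the unit ball is applied to \<open>v\<close> divided by its
  length. The zero vector cannot be normalised and is treated separately.\<close>

lemma norm2_mult_vec:
  assumes A: "A \<in> carrier_mat nr nc" and v: "v \<in> carrier_vec nc"
  shows "vnorm2 (A *\<^sub>v v) \<le> norm2 A * vnorm2 v"
proof (cases "vnorm2 v = 0")
  case True
  then have "v = 0\<^sub>v nc" using v vnorm2_eq_0 by blast
  then have "A *\<^sub>v v = 0\<^sub>v nr" using A by auto
  then show ?thesis by simp
next
  case False
  then have pos: "0 < vnorm2 v" using vnorm2_nonneg[of v] by linarith
  have "vnorm2 (A *\<^sub>v (inverse (vnorm2 v) \<cdot>\<^sub>v v)) \<le> norm2 A"
    by (rule norm2_mult_vec_le_1) (use A v pos in \<open>auto simp: vnorm2_smult\<close>)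
  also have "A *\<^sub>v (inverse (vnorm2 v) \<cdot>\<^sub>v v) = inverse (vnorm2 v) \<cdot>\<^sub>v (A *\<^sub>v v)"
    using A v by (rule mult_mat_vec)
  finally show ?thesis using pos by (simp add: vnorm2_smult field_simps)
qed

text \<open>Every upper bound on \<open>norm2\<close> below goes through this rule. The sign of
  \<open>c\<close> matters: for \<open>nc = 0\<close> the pointwise condition holds for every
  \<open>c\<close>, while \<open>norm2 A\<close> is 0.\<close>

lemma norm2_leI:
  assumes A: "A \<in> carrier_mat nr nc" and "0 \<le> c"
    and le: "\<And>v. v \<in> carrier_vec nc \<Longrightarrow> vnorm2 (A *\<^sub>v v) \<le> c * vnorm2 v"
  shows "norm2 A \<le> c"
  unfolding norm2_def
proof (rule cSUP_least)
  show "{v \<in> carrier_vec (dim_col A). vnorm2 v \<le> 1} \<noteq> {}"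
    by (auto intro!: exI[of _ "0\<^sub>v (dim_col A)"])
next
  fix v assume v: "v \<in> {v \<in> carrier_vec (dim_col A). vnorm2 v \<le> 1}"
  then have "vnorm2 (A *\<^sub>v v) \<le> c * vnorm2 v" using A le by auto
  also have "\<dots> \<le> c" using v \<open>0 \<le> c\<close> by (simp add: mult_left_le)
  finally show "vnorm2 (A *\<^sub>v v) \<le> c" .
qed

lemma norm2_triangle:
  assumes A: "A \<in> carrier_mat nr nc" and B: "B \<in> carrier_mat nr nc"
  shows "norm2 (A + B) \<le> norm2 A + norm2 B"
proof (rule norm2_leI)
  fix v :: "real vec" assume v: "v \<in> carrier_vec nc"
  have "vnorm2 ((A + B) *\<^sub>v v) \<le> vnorm2 (A *\<^sub>v v) + vnorm2 (B *\<^sub>v v)"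
    using A B v vnorm2_triangle[of "A *\<^sub>v v" nr "B *\<^sub>v v"] by (simp add: add_mult_distrib_mat_vec)
  also have "\<dots> \<le> (norm2 A + norm2 B) * vnorm2 v"
    using norm2_mult_vec[OF A v] norm2_mult_vec[OF B v] by (simp add: algebra_simps)
  finally show "vnorm2 ((A + B) *\<^sub>v v) \<le> (norm2 A + norm2 B) * vnorm2 v" .
qed (use A B in auto)

lemma norm2_uminus [simp]: "norm2 (- A) = norm2 A"
proof -
  have "vnorm2 (- A *\<^sub>v v) = vnorm2 (A *\<^sub>v v)" if "v \<in> carrier_vec (dim_col A)" for v
    using that by (simp add: vnorm2_def)
  then show ?thesis unfolding norm2_def by (intro SUP_cong) auto
qed

lemma norm2_minus_triangle:
  assumes "A \<in> carrier_mat nr nc" "B \<in> carrier_mat nr nc"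
  shows "norm2 (A - B) \<le> norm2 A + norm2 B"
proof -
  have "A - B = A + - B" using assms by (intro eq_matI) auto
  then show ?thesis using norm2_triangle[of A nr nc "- B"] assms by simp
qed

lemma norm2_minus_commute:
  assumes "A \<in> carrier_mat nr nc" "B \<in> carrier_mat nr nc"
  shows "norm2 (A - B) = norm2 (B - A)"
proof -
  have "A - B = - (B - A)" using assms by (intro eq_matI) auto
  then show ?thesis by simp
qed

lemma norm2_mult:
  assumes A: "A \<in> carrier_mat nr n" and B: "B \<in> carrier_mat n nc"
  shows "norm2 (A * B) \<le> norm2 A * norm2 B"
proof (rule norm2_leI)
  fix v :: "real vec" assume v: "v \<in> carrier_vec nc"
  have "vnorm2 ((A * B) *\<^sub>v v) \<le> norm2 A * vnorm2 (B *\<^sub>v v)"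
    using A B v norm2_mult_vec[OF A, of "B *\<^sub>v v"] by simp
  also have "\<dots> \<le> norm2 A * (norm2 B * vnorm2 v)"
    by (intro mult_left_mono norm2_mult_vec[OF B v]) auto
  finally show "vnorm2 ((A * B) *\<^sub>v v) \<le> norm2 A * norm2 B * vnorm2 v" by simp
qed (use A B in auto)

section \<open>Concatenated matrices and column blocks\<close>

lemma hcat_carrier [simp, intro]:
  "A \<in> carrier_mat nr n1 \<Longrightarrow> B \<in> carrier_mat nr n2 \<Longrightarrow> hcat A B \<in> carrier_mat nr (n1 + n2)"
  by (auto simp: hcat_def)

lemma hcat_mult_append:
  assumes A: "A \<in> carrier_mat nr n1" and B: "B \<in> carrier_mat nr n2"
    and v: "v \<in> carrier_vec n1" and w: "w \<in> carrier_vec n2"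
  shows "hcat A B *\<^sub>v (v @\<^sub>v w) = A *\<^sub>v v + B *\<^sub>v w"
proof -
  have "hcat A B *\<^sub>v (v @\<^sub>v w)
      = (A *\<^sub>v v + B *\<^sub>v w) @\<^sub>v (0\<^sub>m 0 n1 *\<^sub>v v + 0\<^sub>m 0 n2 *\<^sub>v w)"
    unfolding hcat_def using A B v w by (subst four_block_mat_mult_vec[OF A B _ _ v w]) auto
  \<comment> \<open>The lower half comes from blocks with no rows, so the appended vector has length
    0.\<close>
  also have "\<dots> = A *\<^sub>v v + B *\<^sub>v w"
    using A B by (intro eq_vecI) auto
  finally show ?thesis .
qed

text \<open>Split the argument into its two parts \<open>v\<close> and \<open>w\<close> and apply
  Cauchy-Schwarz in the plane to the pairs (norm of \<open>A\<close>, norm of \<open>B\<close>) and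
  (length of \<open>v\<close>, length of \<open>w\<close>).\<close>

lemma norm2_hcat_sq_le:
  assumes A: "A \<in> carrier_mat nr n1" and B: "B \<in> carrier_mat nr n2"
  shows "norm2 (hcat A B) ^ 2 \<le> norm2 A ^ 2 + norm2 B ^ 2"
proof -
  have "norm2 (hcat A B) \<le> sqrt (norm2 A ^ 2 + norm2 B ^ 2)"
  proof (rule norm2_leI)
    fix x :: "real vec" assume x: "x \<in> carrier_vec (n1 + n2)"
    define v w where "v = vec_first x n1" and "w = vec_last x n2"
    have v: "v \<in> carrier_vec n1" and w: "w \<in> carrier_vec n2" and vw: "x = v @\<^sub>v w"
      using x by (auto simp: v_def w_def)
    have "vnorm2 (hcat A B *\<^sub>v x) = vnorm2 (A *\<^sub>v v + B *\<^sub>v w)"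
      unfolding vw hcat_mult_append[OF A B v w] ..
    also have "\<dots> \<le> vnorm2 (A *\<^sub>v v) + vnorm2 (B *\<^sub>v w)"
      using A B v w by (intro vnorm2_triangle[of _ nr]) auto
    also have "\<dots> \<le> norm2 A * vnorm2 v + norm2 B * vnorm2 w"
      by (intro add_mono norm2_mult_vec[OF A v] norm2_mult_vec[OF B w])
    also have "\<dots> \<le> sqrt ((norm2 A ^ 2 + norm2 B ^ 2) * (vnorm2 v ^ 2 + vnorm2 w ^ 2))"
    proof (rule real_le_rsqrt)
      \<comment> \<open>Lagrange's identity: the gap in the Cauchy-Schwarz inequality is a perfect
        square.\<close>
      have "(norm2 A ^ 2 + norm2 B ^ 2) * (vnorm2 v ^ 2 + vnorm2 w ^ 2)
          - (norm2 A * vnorm2 v + norm2 B * vnorm2 w) ^ 2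
          = (norm2 A * vnorm2 w - norm2 B * vnorm2 v) ^ 2"
        by (simp add: power2_eq_square algebra_simps)
      then show "(norm2 A * vnorm2 v + norm2 B * vnorm2 w) ^ 2
          \<le> (norm2 A ^ 2 + norm2 B ^ 2) * (vnorm2 v ^ 2 + vnorm2 w ^ 2)"
        using zero_le_power2[of "norm2 A * vnorm2 w - norm2 B * vnorm2 v"] by linarith
    qed
    also have "\<dots> = sqrt (norm2 A ^ 2 + norm2 B ^ 2) * vnorm2 x"
      by (simp add: real_sqrt_mult vw flip: vnorm2_append_sq)
    finally show "vnorm2 (hcat A B *\<^sub>v x) \<le> sqrt (norm2 A ^ 2 + norm2 B ^ 2) * vnorm2 x" .
  qed (use A B in auto)
  then show ?thesis
    by (metis norm2_nonneg power_mono real_sqrt_pow2 add_nonneg_nonneg zero_le_power2)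
qed

text \<open>Padding a vector with zeros preserves its length and makes the concatenation act as one
  of its blocks.\<close>

lemma norm2_le_hcat:
  assumes A: "A \<in> carrier_mat nr n1" and B: "B \<in> carrier_mat nr n2"
  shows "norm2 A \<le> norm2 (hcat A B)" "norm2 B \<le> norm2 (hcat A B)"
proof -
  note AB = hcat_carrier[OF A B]
  show "norm2 A \<le> norm2 (hcat A B)"
  proof (rule norm2_leI[OF A])
    fix v :: "real vec" assume v: "v \<in> carrier_vec n1"
    have "hcat A B *\<^sub>v (v @\<^sub>v 0\<^sub>v n2) = A *\<^sub>v v"
      using A B v by (simp add: hcat_mult_append[OF A B] mult_mat_zero_vec)
    moreover have "vnorm2 (v @\<^sub>v 0\<^sub>v n2) = vnorm2 v"
      by (rule power2_eq_imp_eq) (auto simp: vnorm2_append_sq)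
    ultimately show "vnorm2 (A *\<^sub>v v) \<le> norm2 (hcat A B) * vnorm2 v"
      using norm2_mult_vec[OF AB, of "v @\<^sub>v 0\<^sub>v n2"] v by auto
  qed auto
  show "norm2 B \<le> norm2 (hcat A B)"
  proof (rule norm2_leI[OF B])
    fix v :: "real vec" assume v: "v \<in> carrier_vec n2"
    have "hcat A B *\<^sub>v (0\<^sub>v n1 @\<^sub>v v) = B *\<^sub>v v"
      using A B v by (simp add: hcat_mult_append[OF A B] mult_mat_zero_vec)
    moreover have "vnorm2 (0\<^sub>v n1 @\<^sub>v v) = vnorm2 v"
      by (rule power2_eq_imp_eq) (auto simp: vnorm2_append_sq)
    ultimately show "vnorm2 (B *\<^sub>v v) \<le> norm2 (hcat A B) * vnorm2 v"
      using norm2_mult_vec[OF AB, of "0\<^sub>v n1 @\<^sub>v v"] v by auto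
  qed auto
qed

lemma hcat_minus:
  assumes "A \<in> carrier_mat nr n1" "B \<in> carrier_mat nr n2"
    "C \<in> carrier_mat nr n1" "D \<in> carrier_mat nr n2"
  shows "hcat A B - hcat C D = hcat (A - C) (B - D)"
  using assms by (intro eq_matI) (auto simp: hcat_def)

text \<open>One step of the recursion for the product of the computed factors: \<open>hcat\<close>
  is a block matrix with an empty lower row of blocks, so block multiplication applies, and the zero
  block of the triangular factor removes \<open>Q\<close> from the left part.\<close>

lemma hcat_mult_upper:
  assumes U: "U \<in> carrier_mat m t" and Q: "Q \<in> carrier_mat m p"
    and R: "R \<in> carrier_mat t t" and S: "S \<in> carrier_mat t p" and T: "T \<in> carrier_mat p p"
  shows "hcat U Q * four_block_mat R S (0\<^sub>m p t) T = hcat (U * R) (U * S + Q * T)"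
  unfolding hcat_def using assms
  by (subst mult_four_block_mat[where ?nr2.0 = 0 and ?n1.0 = t and ?n2.0 = p and ?nr1.0 = m
        and ?nc1.0 = t and ?nc2.0 = p]) auto

lemma leading_blocks_Suc:
  "leading_blocks p A (Suc k) = hcat (leading_blocks p A k) (col_block p A (Suc k))"
  by (intro eq_matI) (auto simp: leading_blocks_def col_block_def hcat_def add.commute)

lemma leading_blocks_1: "leading_blocks p A (Suc 0) = col_block p A (Suc 0)"
  by (intro eq_matI) (auto simp: leading_blocks_def col_block_def)

lemma leading_blocks_all: "A \<in> carrier_mat m (s * p) \<Longrightarrow> leading_blocks p A s = A"
  by (intro eq_matI) (auto simp: leading_blocks_def)

lemma leading_blocks_carrier: "A \<in> carrier_mat m n \<Longrightarrow> leading_blocks p A k \<in> carrier_mat m (k * p)"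
  by (auto simp: leading_blocks_def)

lemma col_block_carrier: "A \<in> carrier_mat m n \<Longrightarrow> col_block p A k \<in> carrier_mat m p"
  by (auto simp: col_block_def)

section \<open>Matrices with nearly orthonormal columns\<close>

text \<open>The squared length of Qv is the quadratic form of Q^T Q, here split into the identity
  minus the defect. A bound on the defect thus controls this length from above and from
  below.\<close>

lemma vnorm2_mult_sq:
  assumes Q: "Q \<in> carrier_mat m p" and v: "v \<in> carrier_vec p"
  shows "vnorm2 (Q *\<^sub>v v) ^ 2 = vnorm2 v ^ 2 - v \<bullet> ((1\<^sub>m p - Q\<^sup>T * Q) *\<^sub>v v)"
proof -
  have "(1\<^sub>m p - Q\<^sup>T * Q) *\<^sub>v v = v - Q\<^sup>T *\<^sub>v (Q *\<^sub>v v)"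
    using Q v by (subst minus_mult_distrib_mat_vec[where nr = p and nc = p]) auto
  moreover have "v \<bullet> (v - Q\<^sup>T *\<^sub>v (Q *\<^sub>v v)) = v \<bullet> v - v \<bullet> (Q\<^sup>T *\<^sub>v (Q *\<^sub>v v))"
    using Q v by (intro scalar_prod_minus_distrib[of _ p]) auto
  moreover have "v \<bullet> (Q\<^sup>T *\<^sub>v (Q *\<^sub>v v)) = (Q *\<^sub>v v) \<bullet> (Q *\<^sub>v v)"
    using Q v by (simp add: comm_scalar_prod[of v p] transpose_vec_mult_scalar[of Q m p])
  ultimately show ?thesis by (simp add: vnorm2_sq)
qed

lemma abs_defect_le:
  assumes Q: "Q \<in> carrier_mat m p" and v: "v \<in> carrier_vec p"
    and a: "norm2 (1\<^sub>m p - Q\<^sup>T * Q) \<le> a"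
  shows "\<bar>v \<bullet> ((1\<^sub>m p - Q\<^sup>T * Q) *\<^sub>v v)\<bar> \<le> a * vnorm2 v ^ 2"
proof -
  let ?E = "1\<^sub>m p - Q\<^sup>T * Q"
  have E: "?E \<in> carrier_mat p p" using Q by auto
  have "\<bar>v \<bullet> (?E *\<^sub>v v)\<bar> \<le> vnorm2 v * vnorm2 (?E *\<^sub>v v)"
    using E v by (intro scalar_prod_le_vnorm2) auto
  also have "\<dots> \<le> vnorm2 v * (a * vnorm2 v)"
    by (intro mult_left_mono order_trans[OF norm2_mult_vec[OF E v]] mult_right_mono a) auto
  finally show ?thesis by (simp add: power2_eq_square mult_ac)
qed

text \<open>The quadratic form gives the bound sqrt (1 + a). It is relaxed to 1 + a, which avoids
  the root and is still 1 + O(\<epsilon>) when \<open>a\<close> is O(\<epsilon>).\<close>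

lemma norm2_near_orthogonal_le:
  assumes Q: "Q \<in> carrier_mat m p" and a: "norm2 (1\<^sub>m p - Q\<^sup>T * Q) \<le> a"
  shows "norm2 Q \<le> 1 + a"
proof (rule norm2_leI[OF Q])
  show a0: "0 \<le> 1 + a" using a norm2_nonneg[of "1\<^sub>m p - Q\<^sup>T * Q"] by linarith
  fix v :: "real vec" assume v: "v \<in> carrier_vec p"
  have "vnorm2 (Q *\<^sub>v v) ^ 2 \<le> (1 + a) * vnorm2 v ^ 2"
    using vnorm2_mult_sq[OF Q v] abs_defect_le[OF Q v a] by (simp add: algebra_simps)
  also have "\<dots> \<le> (1 + a) ^ 2 * vnorm2 v ^ 2"
    using a order_trans[OF norm2_nonneg a]
    by (intro mult_right_mono) (auto simp: power2_eq_square algebra_simps)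
  finally have "vnorm2 (Q *\<^sub>v v) ^ 2 \<le> ((1 + a) * vnorm2 v) ^ 2" by (simp add: power_mult_distrib)
  then show "vnorm2 (Q *\<^sub>v v) \<le> (1 + a) * vnorm2 v"
    by (rule power2_le_imp_le) (use a0 in auto)
qed

text \<open>A defect below 1 makes \<open>Q\<close> injective with a quantitative lower bound: it
  shrinks lengths at most by the factor sqrt (1 - a), hence at most by 1 - a. Applied to the vectors
  Rv, this transfers a bound on the product to \<open>R\<close>.\<close>

lemma norm2_right_factor_le:
  assumes Q: "Q \<in> carrier_mat m p" and R: "R \<in> carrier_mat p n"
    and a: "norm2 (1\<^sub>m p - Q\<^sup>T * Q) \<le> a" "a < 1"
  shows "norm2 R \<le> norm2 (Q * R) / (1 - a)"
proof (rule norm2_leI[OF R])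
  show "0 \<le> norm2 (Q * R) / (1 - a)" using a by auto
  fix v :: "real vec" assume v: "v \<in> carrier_vec n"
  let ?w = "R *\<^sub>v v"
  have w: "?w \<in> carrier_vec p" using R v by auto
  have a0: "0 \<le> a" using a norm2_nonneg[of "1\<^sub>m p - Q\<^sup>T * Q"] by linarith
  have "((1 - a) * vnorm2 ?w) ^ 2 = ((1 - a) * (1 - a)) * vnorm2 ?w ^ 2"
    by (simp add: power2_eq_square mult_ac)
  \<comment> \<open>As 1 - a lies between 0 and 1, it dominates its own square.\<close>
  also have "\<dots> \<le> (1 - a) * vnorm2 ?w ^ 2"
    using a a0 by (intro mult_right_mono mult_left_le) auto
  also have "\<dots> \<le> vnorm2 (Q *\<^sub>v ?w) ^ 2"
    using vnorm2_mult_sq[OF Q w] abs_defect_le[OF Q w a(1)] by (simp add: algebra_simps)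
  finally have "(1 - a) * vnorm2 ?w \<le> vnorm2 (Q *\<^sub>v ?w)"
    by (rule power2_le_imp_le) auto
  also have "Q *\<^sub>v ?w = (Q * R) *\<^sub>v v" using Q R v by simp
  also have "vnorm2 ((Q * R) *\<^sub>v v) \<le> norm2 (Q * R) * vnorm2 v"
    using Q R v by (intro norm2_mult_vec) auto
  finally show "vnorm2 ?w \<le> norm2 (Q * R) / (1 - a) * vnorm2 v"
    using a by (simp add: field_simps)
qed

text \<open>With b = Bv and w = U^T b, the squared length of b - Uw is |b|^2 - 2 |w|^2 + |Uw|^2, and
  a defect of at most 1 gives |Uw|^2 \<le> 2 |w|^2. So the bound holds without any first-order error
  term, although \<open>U\<close> is only nearly orthogonal.\<close>

lemma norm2_projection_complement_le:
  assumes U: "U \<in> carrier_mat m t" and B: "B \<in> carrier_mat m p"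
    and u: "norm2 (1\<^sub>m t - U\<^sup>T * U) \<le> 1"
  shows "norm2 (B - U * (U\<^sup>T * B)) \<le> norm2 B"
proof (rule norm2_leI)
  show "B - U * (U\<^sup>T * B) \<in> carrier_mat m p" using U B by auto
  fix v :: "real vec" assume v: "v \<in> carrier_vec p"
  define b where "b = B *\<^sub>v v"
  define w where "w = U\<^sup>T *\<^sub>v b"
  have b: "b \<in> carrier_vec m" using B v by (auto simp: b_def)
  have w: "w \<in> carrier_vec t" using U b by (auto simp: w_def)
  have Uw: "U *\<^sub>v w \<in> carrier_vec m" using U w by auto
  have "(U * (U\<^sup>T * B)) *\<^sub>v v = U *\<^sub>v ((U\<^sup>T * B) *\<^sub>v v)"
    using U B v by (intro assoc_mult_mat_vec[of _ m t _ p]) auto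
  also have "(U\<^sup>T * B) *\<^sub>v v = w"
    using U B v unfolding w_def b_def by (intro assoc_mult_mat_vec[of _ t m _ p]) auto
  finally have "(B - U * (U\<^sup>T * B)) *\<^sub>v v = b - U *\<^sub>v w"
    using U B v by (subst minus_mult_distrib_mat_vec[of _ m p]) (auto simp: b_def)
  moreover have "vnorm2 (b - U *\<^sub>v w) \<le> vnorm2 b"
  proof (rule power2_le_imp_le)
    have bUw: "b \<bullet> (U *\<^sub>v w) = vnorm2 w ^ 2"
      using transpose_vec_mult_scalar[OF U w b] by (simp add: w_def vnorm2_sq)
    have "vnorm2 (b - U *\<^sub>v w) ^ 2 = vnorm2 b ^ 2 - 2 * (b \<bullet> (U *\<^sub>v w)) + vnorm2 (U *\<^sub>v w) ^ 2"
      using b Uw unfolding vnorm2_sq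
      by (simp add: minus_scalar_prod_distrib[of _ m] scalar_prod_minus_distrib[of _ m]
          comm_scalar_prod[of "U *\<^sub>v w" m b])
    also have "\<dots> \<le> vnorm2 b ^ 2"
      using vnorm2_mult_sq[OF U w] abs_defect_le[OF U w u] bUw by simp
    finally show "vnorm2 (b - U *\<^sub>v w) ^ 2 \<le> vnorm2 b ^ 2" .
  qed auto
  moreover have "vnorm2 b \<le> norm2 B * vnorm2 v"
    unfolding b_def by (rule norm2_mult_vec[OF B v])
  ultimately show "vnorm2 ((B - U * (U\<^sup>T * B)) *\<^sub>v v) \<le> norm2 B * vnorm2 v" by simp
qed auto

section \<open>Residual of one reorthogonalized block step\<close>

text \<open>A purely algebraic telescoping identity, hence stated over any ring. The differences on
  the right are exactly those bounded by the error contracts of the two steps and of the final sums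
  and products.\<close>

lemma CGS2_step_residual_eq:
  fixes B :: "'a :: ring mat"
  assumes c: "U \<in> carrier_mat m t" "Q1 \<in> carrier_mat m p" "R1 \<in> carrier_mat p n"
    "S1 \<in> carrier_mat t n" "Y1 \<in> carrier_mat m n" "Y2 \<in> carrier_mat m p"
    "Q \<in> carrier_mat m q" "R2 \<in> carrier_mat q p" "S2 \<in> carrier_mat t p"
    "R \<in> carrier_mat q n" "S \<in> carrier_mat t n" "B \<in> carrier_mat m n"
  shows "B - (U * S + Q * R) =
    U * ((S1 + S2 * R1) - S) + Q * (R2 * R1 - R) + ((Q1 - U * S2 - Y2) - (Q * R2 - Y2)) * R1
      + ((B - U * S1 - Y1) - (Q1 * R1 - Y1))"
proof -
  have carriers: "U * S \<in> carrier_mat m n" "Q * R \<in> carrier_mat m n" "U * S1 \<in> carrier_mat m n"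
    "U * S2 * R1 \<in> carrier_mat m n" "Q * R2 * R1 \<in> carrier_mat m n" "Q1 * R1 \<in> carrier_mat m n"
    "U * S2 \<in> carrier_mat m p" "Q * R2 \<in> carrier_mat m p" "S2 * R1 \<in> carrier_mat t n"
    "R2 * R1 \<in> carrier_mat q n" "S1 + S2 * R1 \<in> carrier_mat t n"
    using c by auto
  have "U * ((S1 + S2 * R1) - S) = U * (S1 + S2 * R1) - U * S"
    by (rule mult_minus_distrib_mat) (use c carriers in auto)
  also have "U * (S1 + S2 * R1) = U * S1 + U * (S2 * R1)"
    by (rule mult_add_distrib_mat) (use c carriers in auto)
  also have "U * (S2 * R1) = U * S2 * R1"
    by (rule assoc_mult_mat[symmetric]) (use c in auto)
  finally have 1: "U * ((S1 + S2 * R1) - S) = U * S1 + U * S2 * R1 - U * S" .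
  have "Q * (R2 * R1 - R) = Q * (R2 * R1) - Q * R"
    by (rule mult_minus_distrib_mat) (use c carriers in auto)
  also have "Q * (R2 * R1) = Q * R2 * R1"
    by (rule assoc_mult_mat[symmetric]) (use c in auto)
  finally have 2: "Q * (R2 * R1 - R) = Q * R2 * R1 - Q * R" .
  have cancel: "(q - x - y) - (z - y) = q - x - z"
    if "q \<in> carrier_mat m p" "x \<in> carrier_mat m p" "y \<in> carrier_mat m p" "z \<in> carrier_mat m p"
    for q x y z :: "'a mat"
    using that by (intro eq_matI) auto
  have "((Q1 - U * S2 - Y2) - (Q * R2 - Y2)) * R1 = (Q1 - U * S2 - Q * R2) * R1"
    using c carriers by (subst cancel) auto
  also have "\<dots> = (Q1 - U * S2) * R1 - Q * R2 * R1"
    by (rule minus_mult_distrib_mat) (use c carriers in auto)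
  also have "(Q1 - U * S2) * R1 = Q1 * R1 - U * S2 * R1"
    by (rule minus_mult_distrib_mat) (use c carriers in auto)
  finally have 3: "((Q1 - U * S2 - Y2) - (Q * R2 - Y2)) * R1
    = Q1 * R1 - U * S2 * R1 - Q * R2 * R1" .
  \<comment> \<open>Once all products are expanded, they are abstracted to variables; what is left
    is an additive identity that holds entry by entry.\<close>
  have "b - (us + qr) = (us1 + usr - us) + (qrr - qr) + (q1r1 - usr - qrr)
      + ((b - us1 - y) - (q1r1 - y))"
    if "b \<in> carrier_mat m n" "us \<in> carrier_mat m n" "qr \<in> carrier_mat m n" "us1 \<in> carrier_mat m n"
      "usr \<in> carrier_mat m n" "qrr \<in> carrier_mat m n" "q1r1 \<in> carrier_mat m n" "y \<in> carrier_mat m n"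
    for b us qr us1 usr qrr q1r1 y :: "'a mat"
    using that by (intro eq_matI) auto
  from this[OF \<open>B \<in> carrier_mat m n\<close> carriers(1-6) \<open>Y1 \<in> carrier_mat m n\<close>]
  show ?thesis unfolding 1 2 3 .
qed

text \<open>Triangle inequality and submultiplicativity on the identity above. Of the factors on the
  right, only \<open>R1\<close> has no bound directly from a contract or from near orthogonality;
  the next lemma prepares one.\<close>

lemma CGS2_step_residual_le:
  assumes c: "U \<in> carrier_mat m t" "Q1 \<in> carrier_mat m p" "R1 \<in> carrier_mat p n"
    "S1 \<in> carrier_mat t n" "Y1 \<in> carrier_mat m n" "Y2 \<in> carrier_mat m p"
    "Q \<in> carrier_mat m q" "R2 \<in> carrier_mat q p" "S2 \<in> carrier_mat t p"
    "R \<in> carrier_mat q n" "S \<in> carrier_mat t n" "B \<in> carrier_mat m n"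
  shows "norm2 (B - (U * S + Q * R)) \<le>
    norm2 U * norm2 ((S1 + S2 * R1) - S) + norm2 Q * norm2 (R2 * R1 - R)
      + (norm2 (Q1 - U * S2 - Y2) + norm2 (Q * R2 - Y2)) * norm2 R1
      + (norm2 (B - U * S1 - Y1) + norm2 (Q1 * R1 - Y1))"
proof -
  let ?a = "U * ((S1 + S2 * R1) - S)" and ?b = "Q * (R2 * R1 - R)"
    and ?e = "(Q1 - U * S2 - Y2) - (Q * R2 - Y2)" and ?d = "(B - U * S1 - Y1) - (Q1 * R1 - Y1)"
  have "norm2 (?a + ?b + ?e * R1 + ?d) \<le> norm2 (?a + ?b + ?e * R1) + norm2 ?d"
    using c by (intro norm2_triangle[of _ m n]) auto
  moreover have "norm2 (?a + ?b + ?e * R1) \<le> norm2 (?a + ?b) + norm2 (?e * R1)"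
    using c by (intro norm2_triangle[of _ m n]) auto
  moreover have "norm2 (?a + ?b) \<le> norm2 ?a + norm2 ?b"
    using c by (intro norm2_triangle[of _ m n]) auto
  moreover have "norm2 ?a \<le> norm2 U * norm2 ((S1 + S2 * R1) - S)"
    using c by (intro norm2_mult[of _ m t _ n]) auto
  moreover have "norm2 ?b \<le> norm2 Q * norm2 (R2 * R1 - R)"
    using c by (intro norm2_mult[of _ m q _ n]) auto
  moreover have "norm2 (?e * R1) \<le> norm2 ?e * norm2 R1"
    using c by (intro norm2_mult[of _ m p _ n]) auto
  moreover have "norm2 ?e * norm2 R1
      \<le> (norm2 (Q1 - U * S2 - Y2) + norm2 (Q * R2 - Y2)) * norm2 R1"
    using c by (intro mult_right_mono norm2_minus_triangle[of _ m p]) auto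
  moreover have "norm2 ?d \<le> norm2 (B - U * S1 - Y1) + norm2 (Q1 * R1 - Y1)"
    using c by (intro norm2_minus_triangle[of _ m n]) auto
  ultimately show ?thesis unfolding CGS2_step_residual_eq[OF c] by linarith
qed

text \<open>Writes \<open>Q * R\<close> as the exact projection complement of \<open>B\<close> plus
  three perturbations. Keeping the projection together gives \<open>norm2 B\<close> the coefficient
  1; separate estimates of \<open>B\<close> and \<open>U * S\<close> would give about 2 and spoil
  the constants in \<open>f_resid\<close>.\<close>

lemma CGS_step_QR_le:
  assumes c: "U \<in> carrier_mat m t" "Q \<in> carrier_mat m p" "R \<in> carrier_mat p n"
    "S \<in> carrier_mat t n" "Y \<in> carrier_mat m n" "B \<in> carrier_mat m n"
    and u: "norm2 (1\<^sub>m t - U\<^sup>T * U) \<le> 1"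
  shows "norm2 (Q * R) \<le>
    norm2 B + norm2 U * norm2 (U\<^sup>T * B - S) + norm2 (B - U * S - Y) + norm2 (Q * R - Y)"
proof -
  have UU: "U * (U\<^sup>T * B - S) = U * (U\<^sup>T * B) - U * S"
    by (rule mult_minus_distrib_mat) (use c in auto)
  have carriers: "U * (U\<^sup>T * B) \<in> carrier_mat m n" "U * S \<in> carrier_mat m n" "Q * R \<in> carrier_mat m n"
    using c by auto
  have "qr = (b - uu) + (uu - us) - (b - us - y) + (qr - y)"
    if "qr \<in> carrier_mat m n" "b \<in> carrier_mat m n" "uu \<in> carrier_mat m n"
      "us \<in> carrier_mat m n" "y \<in> carrier_mat m n"
    for qr b uu us y :: "real mat"
    using that by (intro eq_matI) auto
  from this[OF carriers(3) \<open>B \<in> carrier_mat m n\<close> carriers(1,2) \<open>Y \<in> carrier_mat m n\<close>]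
  have "norm2 (Q * R)
      = norm2 ((B - U * (U\<^sup>T * B)) + U * (U\<^sup>T * B - S) - (B - U * S - Y) + (Q * R - Y))"
    unfolding UU by (rule arg_cong)
  also have "\<dots> \<le> norm2 ((B - U * (U\<^sup>T * B)) + U * (U\<^sup>T * B - S) - (B - U * S - Y))
      + norm2 (Q * R - Y)"
    using c carriers by (intro norm2_triangle[of _ m n]) auto
  also have "norm2 ((B - U * (U\<^sup>T * B)) + U * (U\<^sup>T * B - S) - (B - U * S - Y))
      \<le> norm2 ((B - U * (U\<^sup>T * B)) + U * (U\<^sup>T * B - S)) + norm2 (B - U * S - Y)"
    using c carriers by (intro norm2_minus_triangle[of _ m n]) auto
  also have "norm2 ((B - U * (U\<^sup>T * B)) + U * (U\<^sup>T * B - S))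
      \<le> norm2 (B - U * (U\<^sup>T * B)) + norm2 (U * (U\<^sup>T * B - S))"
    using c carriers by (intro norm2_triangle[of _ m n]) auto
  also have "norm2 (B - U * (U\<^sup>T * B)) \<le> norm2 B"
    using c u by (intro norm2_projection_complement_le[of _ m t _ n]) auto
  also have "norm2 (U * (U\<^sup>T * B - S)) \<le> norm2 U * norm2 (U\<^sup>T * B - S)"
    using c by (intro norm2_mult[of _ m t _ n]) auto
  finally show ?thesis by simp
qed

section \<open>First-order estimates in the machine unit\<close>

text \<open>Trades the Landau term for an explicit constant. Only the upper bound is kept, and the
  sign of \<open>C\<close> lets such constants be added and multiplied in later
  inequalities.\<close>

lemma bigo_eps2_eventually_le:
  assumes "h \<in> O[at_right 0](\<lambda>\<epsilon>::real. \<epsilon> ^ 2)"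
  obtains C :: real where "0 \<le> C" "\<forall>\<^sub>F \<epsilon> in at_right 0. h \<epsilon> \<le> C * \<epsilon> ^ 2"
proof -
  from assms obtain C where C: "0 < C" "\<forall>\<^sub>F \<epsilon> in at_right 0. norm (h \<epsilon>) \<le> C * norm (\<epsilon> ^ 2 :: real)"
    by (rule landau_o.bigE)
  then have "\<forall>\<^sub>F \<epsilon> in at_right 0. h \<epsilon> \<le> C * \<epsilon> ^ 2"
    by (auto elim!: eventually_mono)
  with C show thesis by (intro that[of C]) auto
qed

lemma le_upto_eps2E:
  assumes "le_upto_eps2 f g"
  obtains C where "0 \<le> C" "\<forall>\<^sub>F \<epsilon> in at_right 0. f \<epsilon> \<le> g \<epsilon> + C * \<epsilon> ^ 2"
proof -
  from assms obtain h where h: "h \<in> O[at_right 0](\<lambda>\<epsilon>. \<epsilon> ^ 2)"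
    and le: "\<forall>\<^sub>F \<epsilon> in at_right 0. f \<epsilon> \<le> g \<epsilon> + h \<epsilon>"
    unfolding le_upto_eps2_def by blast
  from h obtain C where "0 \<le> C" and C: "\<forall>\<^sub>F \<epsilon> in at_right 0. h \<epsilon> \<le> C * \<epsilon> ^ 2"
    by (rule bigo_eps2_eventually_le)
  show thesis
    by (rule that[OF \<open>0 \<le> C\<close>]) (use le C in eventually_elim, simp)
qed

lemma le_upto_eps2I:
  assumes "\<forall>\<^sub>F \<epsilon> in at_right 0. f \<epsilon> \<le> g \<epsilon> + C * \<epsilon> ^ 2"
  shows "le_upto_eps2 f g"
  unfolding le_upto_eps2_def
  by (rule bexI[of _ "\<lambda>\<epsilon>. C * \<epsilon> ^ 2"]) (use assms in auto)

text \<open>Supplies two forms of the defect bound: the linear one controls the norm of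
  \<open>U\<close>, and the bound by 1 is what the projection estimate requires.\<close>

lemma near_left_orthogonalE:
  assumes "near_left_orthogonal f1 m t p U"
  obtains M where "0 \<le> M"
    "\<forall>\<^sub>F \<epsilon> in at_right 0. norm2 (1\<^sub>m t - (U \<epsilon>)\<^sup>T * U \<epsilon>) \<le> \<epsilon> * M \<and> norm2 (1\<^sub>m t - (U \<epsilon>)\<^sup>T * U \<epsilon>) \<le> 1"
proof -
  from assms obtain h where h: "h \<in> O[at_right 0](\<lambda>\<epsilon>. \<epsilon> ^ 2)"
    and ev: "\<forall>\<^sub>F \<epsilon> in at_right 0. norm2 (1\<^sub>m t - (U \<epsilon>)\<^sup>T * U \<epsilon>) \<le> \<epsilon> * f1 m t p + h \<epsilon> \<and>
        \<epsilon> * f1 m t p + h \<epsilon> < 1 \<and> \<epsilon> * f1 m t p < 1"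
    unfolding near_left_orthogonal_def by blast
  from h obtain C where "0 \<le> C" and C: "\<forall>\<^sub>F \<epsilon> in at_right 0. h \<epsilon> \<le> C * \<epsilon> ^ 2"
    by (rule bigo_eps2_eventually_le)
  have "\<forall>\<^sub>F \<epsilon> in at_right 0. 0 < \<epsilon> \<and> \<epsilon> < (1::real)"
    using eventually_at_right_real[of 0 "1::real"] by simp
  then have "\<forall>\<^sub>F \<epsilon> in at_right 0. norm2 (1\<^sub>m t - (U \<epsilon>)\<^sup>T * U \<epsilon>) \<le> \<epsilon> * (\<bar>f1 m t p\<bar> + C)
      \<and> norm2 (1\<^sub>m t - (U \<epsilon>)\<^sup>T * U \<epsilon>) \<le> 1"
    using ev C
  proof eventually_elim
    case (elim \<epsilon>)
    \<comment> \<open>For \<epsilon> below 1 the quadratic remainder is absorbed into the linear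
      constant.\<close>
    have "C * \<epsilon> ^ 2 \<le> C * \<epsilon>"
      using elim \<open>0 \<le> C\<close> by (intro mult_left_mono) (auto simp: power2_eq_square mult_left_le)
    moreover have "\<epsilon> * f1 m t p \<le> \<epsilon> * \<bar>f1 m t p\<bar>" using elim by (intro mult_left_mono) auto
    ultimately show ?case using elim unfolding distrib_left mult.commute[of \<epsilon> C] by linarith
  qed
  then show thesis using \<open>0 \<le> C\<close> by (intro that[of "\<bar>f1 m t p\<bar> + C"]) auto
qed

text \<open>The product of the two expansions has the quadratic term \<epsilon>^2 b d, which
  \<epsilon> \<le> 1 moves into the linear coefficient. The factor \<open>x\<close> may be negative:
  only \<open>y\<close> and the bound for \<open>x\<close> serve as multipliers.\<close>

lemma mult_le_first_order:
  fixes x y a b c d \<epsilon> :: real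
  assumes "0 \<le> y" "0 \<le> a" "0 \<le> b" "0 \<le> c" "0 \<le> d" "0 < \<epsilon>" "\<epsilon> \<le> 1"
    and x: "x \<le> a + \<epsilon> * b" and y: "y \<le> c + \<epsilon> * d"
  shows "x * y \<le> a * c + \<epsilon> * (a * d + b * c + b * d)"
proof -
  have "x * y \<le> (a + \<epsilon> * b) * y" using assms by (intro mult_right_mono) auto
  also have "\<dots> \<le> (a + \<epsilon> * b) * (c + \<epsilon> * d)" using assms by (intro mult_left_mono) auto
  also have "\<dots> = a * c + \<epsilon> * (a * d + b * c + \<epsilon> * (b * d))" by (simp add: algebra_simps)
  also have "\<dots> \<le> a * c + \<epsilon> * (a * d + b * c + b * d)"
    using assms by (intro add_left_mono mult_left_mono mult_left_le_one_le) auto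
  finally show ?thesis .
qed

text \<open>Isolates the scalar part of the step estimate, with \<open>C\<close> fixed before
  \<open>\<epsilon>\<close> and the norms so that it is uniform in them. Here \<open>c1\<close>,
  \<open>d1\<close>, \<open>e1\<close> stand for the errors in \<open>S1\<close>, \<open>Y1\<close>
  and the first factorization, \<open>d2\<close>, \<open>e2\<close> for those in \<open>Y2\<close>
  and the second factorization, \<open>nQR\<close> for the norm of \<open>Q1 * R1\<close>, and
  \<open>l4\<close>, \<open>l5\<close> for the errors of the final combination.\<close>

lemma CGS2_first_order_bound:
  fixes L1 L2 L3 L4 L5 M C1 C2 C3 \<beta> :: real
  assumes nn: "0 \<le> L1" "0 \<le> L2" "0 \<le> L3" "0 \<le> L4" "0 \<le> L5" "0 \<le> M" "0 \<le> C1" "0 \<le> C2" "0 \<le> C3" "0 \<le> \<beta>"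
  obtains C where "0 \<le> C"
    "\<And>\<epsilon> nU nQ1 nQ c1 d1 e1 d2 e2 nR1 nQR l4 l5 :: real.
       \<lbrakk>0 < \<epsilon>; \<epsilon> \<le> 1; \<epsilon> * L1 \<le> 1 / 2; 0 \<le> nU; 0 \<le> nQ1; 0 \<le> nQ; 0 \<le> c1; 0 \<le> d2; 0 \<le> e2; 0 \<le> nR1;
        nU \<le> 1 + \<epsilon> * M; nQ1 \<le> 1 + \<epsilon> * L1; nQ \<le> 1 + \<epsilon> * L1;
        c1 \<le> \<epsilon> * L2 * \<beta> + C1 * \<epsilon> ^ 2; d1 \<le> \<epsilon> * L3 * \<beta> + C2 * \<epsilon> ^ 2; e1 \<le> \<epsilon> * L1 * \<beta>;
        d2 \<le> \<epsilon> * L3 * nQ1 + C3 * \<epsilon> ^ 2; e2 \<le> \<epsilon> * L1 * nQ1;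
        nQR \<le> \<beta> + nU * c1 + d1 + e1; nR1 \<le> nQR / (1 - \<epsilon> * L1);
        l4 \<le> \<epsilon> * L4 * \<beta>; l5 \<le> \<epsilon> * L5 * \<beta>\<rbrakk> \<Longrightarrow>
       nU * l4 + nQ * l5 + (d2 + e2) * nR1 + (d1 + e1)
         \<le> \<epsilon> * (2 * L1 + 2 * L3 + L4 + L5) * \<beta> + C * \<epsilon> ^ 2"
proof -
  \<comment> \<open>The constants follow the chain of estimates: \<open>G\<close> bounds
    \<open>c1\<close> / \<epsilon>, \<open>K1\<close> and \<open>K2\<close> are the linear
    coefficients of \<open>nQR\<close> and \<open>nR1\<close> over \<beta>, \<open>K3\<close> is the
    quadratic coefficient of \<open>d2 + e2\<close>, and \<open>K4\<close> that of its product with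
    \<open>nR1\<close>. In \<open>C\<close>, the first two terms stem from the excess over 1 of
    \<open>nU\<close> and \<open>nQ\<close>, and \<open>C2\<close> from \<open>d1\<close>.\<close>
  define G where "G = L2 * \<beta> + C1"
  define K1 where "K1 = (1 + M) * G + (L3 * \<beta> + C2) + L1 * \<beta>"
  define K2 where "K2 = \<beta> * (2 * L1) + K1 * 1 + K1 * (2 * L1)"
  define K3 where "K3 = (L1 + L3) * L1 + C3"
  define K4 where "K4 = (L1 + L3) * K2 + K3 * \<beta> + K3 * K2"
  define C where "C = M * L4 * \<beta> + L1 * L5 * \<beta> + K4 + C2"
  have G0: "0 \<le> G" and K10: "0 \<le> K1" unfolding K1_def G_def using nn by auto
  then have K20: "0 \<le> K2" and K30: "0 \<le> K3" unfolding K2_def K3_def using nn by auto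
  then have K40: "0 \<le> K4" unfolding K4_def using nn by auto
  then have C0: "0 \<le> C" unfolding C_def using nn by auto
  show thesis
  proof (rule that[OF C0])
    fix \<epsilon> nU nQ1 nQ c1 d1 e1 d2 e2 nR1 nQR l4 l5 :: real
    assume e: "0 < \<epsilon>" "\<epsilon> \<le> 1" "\<epsilon> * L1 \<le> 1 / 2"
      and pos: "0 \<le> nU" "0 \<le> nQ1" "0 \<le> nQ" "0 \<le> c1" "0 \<le> d2" "0 \<le> e2" "0 \<le> nR1"
      and nU: "nU \<le> 1 + \<epsilon> * M" and nQ1: "nQ1 \<le> 1 + \<epsilon> * L1" and nQ: "nQ \<le> 1 + \<epsilon> * L1"
      and c1: "c1 \<le> \<epsilon> * L2 * \<beta> + C1 * \<epsilon> ^ 2" and d1: "d1 \<le> \<epsilon> * L3 * \<beta> + C2 * \<epsilon> ^ 2"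
      and e1: "e1 \<le> \<epsilon> * L1 * \<beta>"
      and d2: "d2 \<le> \<epsilon> * L3 * nQ1 + C3 * \<epsilon> ^ 2" and e2: "e2 \<le> \<epsilon> * L1 * nQ1"
      and nQR: "nQR \<le> \<beta> + nU * c1 + d1 + e1" and nR1: "nR1 \<le> nQR / (1 - \<epsilon> * L1)"
      and l4: "l4 \<le> \<epsilon> * L4 * \<beta>" and l5: "l5 \<le> \<epsilon> * L5 * \<beta>"
    have sq: "c * \<epsilon> ^ 2 \<le> \<epsilon> * c" if "0 \<le> c" for c
      using e that by (simp add: power2_eq_square mult.left_commute mult_left_le mult_left_mono)
    have "nU * c1 \<le> (1 + M) * (\<epsilon> * G)"
    proof (rule mult_mono)
      show "nU \<le> 1 + M" using nU e nn(6) mult_right_mono[of \<epsilon> 1 M] by simp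
      show "c1 \<le> \<epsilon> * G" using c1 sq[OF nn(7)] by (simp add: G_def algebra_simps)
    qed (use pos nn in auto)
    then have QR: "nQR \<le> \<beta> + \<epsilon> * K1"
      using nQR d1 e1 sq[OF nn(8)] by (simp add: K1_def algebra_simps)
    \<comment> \<open>On [0, 1/2] one has 1 / (1 - x) \<le> 1 + 2 x, because (1 + 2 x) (1 - x) = 1 +
      x (1 - 2 x).\<close>
    have inv: "1 / (1 - \<epsilon> * L1) \<le> 1 + \<epsilon> * (2 * L1)"
    proof -
      have "0 \<le> (\<epsilon> * L1) * (1 - 2 * (\<epsilon> * L1))" using e nn by (intro mult_nonneg_nonneg) auto
      then show ?thesis using e by (simp add: field_simps)
    qed
    have "nQR / (1 - \<epsilon> * L1) = nQR * (1 / (1 - \<epsilon> * L1))" by simp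
    also have "\<dots> \<le> \<beta> * 1 + \<epsilon> * K2"
      unfolding K2_def by (rule mult_le_first_order[OF _ _ _ _ _ _ _ QR inv]) (use e nn K10 in auto)
    finally have R1: "nR1 \<le> \<beta> + \<epsilon> * K2" using nR1 by simp
    have "d2 + e2 \<le> \<epsilon> * ((L1 + L3) * nQ1) + C3 * \<epsilon> ^ 2" using d2 e2 by (simp add: algebra_simps)
    also have "\<dots> \<le> \<epsilon> * ((L1 + L3) * (1 + \<epsilon> * L1)) + C3 * \<epsilon> ^ 2"
      using e nn by (intro add_right_mono mult_left_mono nQ1) auto
    also have "\<dots> = \<epsilon> * ((L1 + L3) + \<epsilon> * K3)"
      by (simp add: K3_def power2_eq_square algebra_simps)
    finally have "(d2 + e2) * nR1 \<le> \<epsilon> * ((L1 + L3) + \<epsilon> * K3) * nR1"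
      using pos by (intro mult_right_mono) auto
    also have "\<dots> \<le> \<epsilon> * ((L1 + L3) * \<beta> + \<epsilon> * K4)"
      unfolding K4_def mult.assoc[of \<epsilon>] using e nn K20 K30 pos
      by (intro mult_left_mono mult_le_first_order[OF _ _ _ _ _ _ _ _ R1]) auto
    finally have t3: "(d2 + e2) * nR1 \<le> \<epsilon> * ((L1 + L3) * \<beta> + \<epsilon> * K4)" .
    have "nU * l4 \<le> nU * (\<epsilon> * L4 * \<beta>)" using pos by (intro mult_left_mono l4)
    also have "\<dots> \<le> (1 + \<epsilon> * M) * (\<epsilon> * L4 * \<beta>)" using e nn by (intro mult_right_mono nU) auto
    finally have t1: "nU * l4 \<le> (1 + \<epsilon> * M) * (\<epsilon> * L4 * \<beta>)" .
    have "nQ * l5 \<le> nQ * (\<epsilon> * L5 * \<beta>)" using pos by (intro mult_left_mono l5)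
    also have "\<dots> \<le> (1 + \<epsilon> * L1) * (\<epsilon> * L5 * \<beta>)" using e nn by (intro mult_right_mono nQ) auto
    finally have t2: "nQ * l5 \<le> (1 + \<epsilon> * L1) * (\<epsilon> * L5 * \<beta>)" .
    \<comment> \<open>Both passes contribute \<open>L1 + L3\<close> at first order, which explains
      the two factors 2.\<close>
    show "nU * l4 + nQ * l5 + (d2 + e2) * nR1 + (d1 + e1)
         \<le> \<epsilon> * (2 * L1 + 2 * L3 + L4 + L5) * \<beta> + C * \<epsilon> ^ 2"
      using t1 t2 t3 d1 e1 by (simp add: C_def algebra_simps power2_eq_square)
  qed
qed

section \<open>Residual of the computed step\<close>

text \<open>Feeds the error contracts into the scalar estimate. The block \<open>B\<close> does not
  depend on \<epsilon>, so its norm is a legitimate constant; the second pass has the varying input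
  \<open>Q1\<close>, whose norm is at most 1 + \<epsilon> \<open>L1 m p\<close>.\<close>

lemma computed_block_CGS2_step_residual:
  assumes CGS2: "computed_block_CGS2_step L1 L2 L3 L4 L5 m t p U (\<lambda>_. B) Q R S"
    and U: "\<forall>\<^sub>F \<epsilon> in at_right 0. U \<epsilon> \<in> carrier_mat m t"
    and near: "near_left_orthogonal f1 m t p U"
    and B: "B \<in> carrier_mat m p"
    and nn: "0 \<le> L1 m p" "0 \<le> L2 m t p" "0 \<le> L3 t p" "0 \<le> L4 p" "0 \<le> L5 p"
  obtains C where "0 \<le> C"
    "\<forall>\<^sub>F \<epsilon> in at_right 0. Q \<epsilon> \<in> carrier_mat m p \<and> R \<epsilon> \<in> carrier_mat p p \<and> S \<epsilon> \<in> carrier_mat t p \<and>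
       norm2 (B - (U \<epsilon> * S \<epsilon> + Q \<epsilon> * R \<epsilon>)) \<le> \<epsilon> * f_resid L1 L3 L4 L5 m t p * norm2 B + C * \<epsilon> ^ 2"
proof -
  from CGS2 obtain Q1 R1 S1 R2 S2 where
    step1: "computed_block_CGS_step L1 L2 L3 m t p U (\<lambda>_. B) Q1 R1 S1" and
    step2: "computed_block_CGS_step L1 L2 L3 m t p U Q1 Q R2 S2" and
    SR: "\<forall>\<^sub>F \<epsilon> in at_right 0.
           S \<epsilon> \<in> carrier_mat t p \<and> R \<epsilon> \<in> carrier_mat p p \<and>
           norm2 ((S1 \<epsilon> + S2 \<epsilon> * R1 \<epsilon>) - S \<epsilon>) \<le> \<epsilon> * L4 p * norm2 B \<and>
           norm2 (R2 \<epsilon> * R1 \<epsilon> - R \<epsilon>) \<le> \<epsilon> * L5 p * norm2 B"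
    unfolding computed_block_CGS2_step_def by blast
  from step1 obtain Y1 where
    c1: "\<forall>\<^sub>F \<epsilon> in at_right 0. S1 \<epsilon> \<in> carrier_mat t p \<and> Y1 \<epsilon> \<in> carrier_mat m p" and
    qr1: "\<forall>\<^sub>F \<epsilon> in at_right 0. qr_factors L1 m p \<epsilon> (norm2 B) (Y1 \<epsilon>) (Q1 \<epsilon>) (R1 \<epsilon>)" and
    S1: "le_upto_eps2 (\<lambda>\<epsilon>. norm2 ((U \<epsilon>)\<^sup>T * B - S1 \<epsilon>)) (\<lambda>\<epsilon>. \<epsilon> * L2 m t p * norm2 B)" and
    Y1: "le_upto_eps2 (\<lambda>\<epsilon>. norm2 ((B - U \<epsilon> * S1 \<epsilon>) - Y1 \<epsilon>)) (\<lambda>\<epsilon>. \<epsilon> * L3 t p * norm2 B)"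
    unfolding computed_block_CGS_step_def by blast
  from step2 obtain Y2 where
    c2: "\<forall>\<^sub>F \<epsilon> in at_right 0. S2 \<epsilon> \<in> carrier_mat t p \<and> Y2 \<epsilon> \<in> carrier_mat m p" and
    qr2: "\<forall>\<^sub>F \<epsilon> in at_right 0. qr_factors L1 m p \<epsilon> (norm2 (Q1 \<epsilon>)) (Y2 \<epsilon>) (Q \<epsilon>) (R2 \<epsilon>)" and
    Y2: "le_upto_eps2 (\<lambda>\<epsilon>. norm2 ((Q1 \<epsilon> - U \<epsilon> * S2 \<epsilon>) - Y2 \<epsilon>)) (\<lambda>\<epsilon>. \<epsilon> * L3 t p * norm2 (Q1 \<epsilon>))"
    unfolding computed_block_CGS_step_def by blast
  obtain M where M0: "0 \<le> M" and M: "\<forall>\<^sub>F \<epsilon> in at_right 0.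
      norm2 (1\<^sub>m t - (U \<epsilon>)\<^sup>T * U \<epsilon>) \<le> \<epsilon> * M \<and> norm2 (1\<^sub>m t - (U \<epsilon>)\<^sup>T * U \<epsilon>) \<le> 1"
    using near by (rule near_left_orthogonalE)
  obtain C1 where C1: "0 \<le> C1" "\<forall>\<^sub>F \<epsilon> in at_right 0.
      norm2 ((U \<epsilon>)\<^sup>T * B - S1 \<epsilon>) \<le> \<epsilon> * L2 m t p * norm2 B + C1 * \<epsilon> ^ 2"
    using S1 by (rule le_upto_eps2E)
  obtain C2 where C2: "0 \<le> C2" "\<forall>\<^sub>F \<epsilon> in at_right 0.
      norm2 ((B - U \<epsilon> * S1 \<epsilon>) - Y1 \<epsilon>) \<le> \<epsilon> * L3 t p * norm2 B + C2 * \<epsilon> ^ 2"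
    using Y1 by (rule le_upto_eps2E)
  obtain C3 where C3: "0 \<le> C3" "\<forall>\<^sub>F \<epsilon> in at_right 0.
      norm2 ((Q1 \<epsilon> - U \<epsilon> * S2 \<epsilon>) - Y2 \<epsilon>) \<le> \<epsilon> * L3 t p * norm2 (Q1 \<epsilon>) + C3 * \<epsilon> ^ 2"
    using Y2 by (rule le_upto_eps2E)
  obtain C where C0: "0 \<le> C" and C:
    "\<And>\<epsilon> nU nQ1 nQ c1 d1 e1 d2 e2 nR1 nQR l4 l5 :: real.
       \<lbrakk>0 < \<epsilon>; \<epsilon> \<le> 1; \<epsilon> * L1 m p \<le> 1 / 2; 0 \<le> nU; 0 \<le> nQ1; 0 \<le> nQ; 0 \<le> c1; 0 \<le> d2; 0 \<le> e2; 0 \<le> nR1;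
        nU \<le> 1 + \<epsilon> * M; nQ1 \<le> 1 + \<epsilon> * L1 m p; nQ \<le> 1 + \<epsilon> * L1 m p;
        c1 \<le> \<epsilon> * L2 m t p * norm2 B + C1 * \<epsilon> ^ 2; d1 \<le> \<epsilon> * L3 t p * norm2 B + C2 * \<epsilon> ^ 2;
        e1 \<le> \<epsilon> * L1 m p * norm2 B;
        d2 \<le> \<epsilon> * L3 t p * nQ1 + C3 * \<epsilon> ^ 2; e2 \<le> \<epsilon> * L1 m p * nQ1;
        nQR \<le> norm2 B + nU * c1 + d1 + e1; nR1 \<le> nQR / (1 - \<epsilon> * L1 m p);
        l4 \<le> \<epsilon> * L4 p * norm2 B; l5 \<le> \<epsilon> * L5 p * norm2 B\<rbrakk> \<Longrightarrow>
       nU * l4 + nQ * l5 + (d2 + e2) * nR1 + (d1 + e1)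
         \<le> \<epsilon> * (2 * L1 m p + 2 * L3 t p + L4 p + L5 p) * norm2 B + C * \<epsilon> ^ 2"
    using CGS2_first_order_bound[OF nn M0 C1(1) C2(1) C3(1) norm2_nonneg[of B]] by blast
  \<comment> \<open>This single threshold yields both \<epsilon> \<le> 1 and \<epsilon>
    \<open>L1 m p\<close> \<le> 1/2.\<close>
  have small: "\<forall>\<^sub>F \<epsilon> in at_right (0::real). 0 < \<epsilon> \<and> \<epsilon> < 1 / (2 * L1 m p + 1)"
    using eventually_at_right_real[of 0 "1 / (2 * L1 m p + 1)"] nn(1) by simp
  show thesis
  proof (rule that[OF C0])
    show "\<forall>\<^sub>F \<epsilon> in at_right 0. Q \<epsilon> \<in> carrier_mat m p \<and> R \<epsilon> \<in> carrier_mat p p \<and> S \<epsilon> \<in> carrier_mat t p \<and>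
       norm2 (B - (U \<epsilon> * S \<epsilon> + Q \<epsilon> * R \<epsilon>)) \<le> \<epsilon> * f_resid L1 L3 L4 L5 m t p * norm2 B + C * \<epsilon> ^ 2"
      using small U M SR c1 c2 qr1 qr2 C1(2) C2(2) C3(2)
    proof eventually_elim
      case (elim \<epsilon>)
      have eps: "0 < \<epsilon>" "\<epsilon> \<le> 1" "\<epsilon> * L1 m p \<le> 1 / 2"
      proof -
        show "0 < \<epsilon>" using elim by simp
        have "\<epsilon> * (2 * L1 m p + 1) \<le> 1" using elim nn(1) by (simp add: field_simps)
        then have "2 * (\<epsilon> * L1 m p) + \<epsilon> \<le> 1" by (simp add: algebra_simps)
        moreover have "0 \<le> \<epsilon> * L1 m p" using elim nn(1) by simp
        ultimately show "\<epsilon> \<le> 1" "\<epsilon> * L1 m p \<le> 1 / 2" using elim by linarith+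
      qed
      have c: "U \<epsilon> \<in> carrier_mat m t" "Q1 \<epsilon> \<in> carrier_mat m p" "R1 \<epsilon> \<in> carrier_mat p p"
        "S1 \<epsilon> \<in> carrier_mat t p" "Y1 \<epsilon> \<in> carrier_mat m p" "Y2 \<epsilon> \<in> carrier_mat m p"
        "Q \<epsilon> \<in> carrier_mat m p" "R2 \<epsilon> \<in> carrier_mat p p" "S2 \<epsilon> \<in> carrier_mat t p"
        "R \<epsilon> \<in> carrier_mat p p" "S \<epsilon> \<in> carrier_mat t p"
        using elim by (auto simp: qr_factors_def)
      have defect: "norm2 (1\<^sub>m p - (Q1 \<epsilon>)\<^sup>T * Q1 \<epsilon>) \<le> \<epsilon> * L1 m p"
        "norm2 (1\<^sub>m p - (Q \<epsilon>)\<^sup>T * Q \<epsilon>) \<le> \<epsilon> * L1 m p"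
        and e1: "norm2 (Q1 \<epsilon> * R1 \<epsilon> - Y1 \<epsilon>) \<le> \<epsilon> * L1 m p * norm2 B"
        and e2: "norm2 (Q \<epsilon> * R2 \<epsilon> - Y2 \<epsilon>) \<le> \<epsilon> * L1 m p * norm2 (Q1 \<epsilon>)"
        using elim by (auto simp: qr_factors_def)
      have "norm2 (B - (U \<epsilon> * S \<epsilon> + Q \<epsilon> * R \<epsilon>)) \<le>
          norm2 (U \<epsilon>) * norm2 ((S1 \<epsilon> + S2 \<epsilon> * R1 \<epsilon>) - S \<epsilon>) + norm2 (Q \<epsilon>) * norm2 (R2 \<epsilon> * R1 \<epsilon> - R \<epsilon>)
          + (norm2 (Q1 \<epsilon> - U \<epsilon> * S2 \<epsilon> - Y2 \<epsilon>) + norm2 (Q \<epsilon> * R2 \<epsilon> - Y2 \<epsilon>)) * norm2 (R1 \<epsilon>)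
          + (norm2 (B - U \<epsilon> * S1 \<epsilon> - Y1 \<epsilon>) + norm2 (Q1 \<epsilon> * R1 \<epsilon> - Y1 \<epsilon>))"
        by (rule CGS2_step_residual_le[OF c B])
      also have "\<dots> \<le> \<epsilon> * (2 * L1 m p + 2 * L3 t p + L4 p + L5 p) * norm2 B + C * \<epsilon> ^ 2"
      proof (rule C[OF eps])
        show "norm2 (U \<epsilon>) \<le> 1 + \<epsilon> * M"
          using elim by (intro norm2_near_orthogonal_le[of _ m t]) auto
        show "norm2 (Q1 \<epsilon>) \<le> 1 + \<epsilon> * L1 m p" "norm2 (Q \<epsilon>) \<le> 1 + \<epsilon> * L1 m p"
          using c defect by (auto intro!: norm2_near_orthogonal_le)
        show "norm2 (Q1 \<epsilon> * R1 \<epsilon>) \<le> norm2 B + norm2 (U \<epsilon>) * norm2 ((U \<epsilon>)\<^sup>T * B - S1 \<epsilon>)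
            + norm2 (B - U \<epsilon> * S1 \<epsilon> - Y1 \<epsilon>) + norm2 (Q1 \<epsilon> * R1 \<epsilon> - Y1 \<epsilon>)"
          using elim by (intro CGS_step_QR_le[OF c(1-5) B]) auto
        show "norm2 (R1 \<epsilon>) \<le> norm2 (Q1 \<epsilon> * R1 \<epsilon>) / (1 - \<epsilon> * L1 m p)"
          using eps by (intro norm2_right_factor_le[OF c(2,3) defect(1)]) auto
      qed (use elim e1 e2 in auto)
      finally show ?case using c by (auto simp: f_resid_def)
    qed
  qed
qed

section \<open>Accumulation over the blocks\<close>

text \<open>Only the \<open>L3\<close> term depends on \<open>t\<close>. The induction needs this to
  raise the bound for the earlier blocks to the level of the newest one.\<close>

lemma f_resid_mono:
  assumes "growth_tp L3" "t \<le> t'" "1 \<le> p"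
  shows "f_resid L1 L3 L4 L5 m t p \<le> f_resid L1 L3 L4 L5 m t' p"
proof -
  have "L3 t p \<le> L3 t' p" using assms unfolding growth_tp_def by blast
  then show ?thesis by (simp add: f_resid_def)
qed

text \<open>Induction on the number of blocks. The factor sqrt k multiplies the remainder as well,
  so that one common bound e serves all blocks and k e^2 + e^2 = (k + 1) e^2 closes the step. The
  dimensions are carried along because the algorithm fixes them only eventually, through its
  recursion.\<close>

lemma BCGS2_residual:
  assumes BCGS2: "computed_BCGS2 L1 L2 L3 L4 L5 m p s A Qhat R"
    and near: "\<forall>k \<in> {1..<s}. near_left_orthogonal f1 m (k * p) p (Qhat k)"
    and A: "A \<in> carrier_mat m n" and mp: "1 \<le> m" "1 \<le> p"
    and growth: "growth_mp L1" "growth_mtp L2" "growth_tp L3" "growth_p L4" "growth_p L5"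
    and k: "1 \<le> k" "k \<le> s"
  shows "\<exists>C \<ge> 0. \<forall>\<^sub>F \<epsilon> in at_right 0.
     Qhat k \<epsilon> \<in> carrier_mat m (k * p) \<and> R k \<epsilon> \<in> carrier_mat (k * p) (k * p) \<and>
     norm2 (leading_blocks p A k - Qhat k \<epsilon> * R k \<epsilon>)
       \<le> sqrt k * (\<epsilon> * f_resid L1 L3 L4 L5 m ((k - 1) * p) p * norm2 (leading_blocks p A k) + C * \<epsilon> ^ 2)"
  using k
proof (induction k rule: nat_induct_at_least)
  have nn: "0 \<le> L1 m p" "0 \<le> L2 m t p" "0 \<le> L3 t p" "0 \<le> L4 p" "0 \<le> L5 p" for t
    using growth mp unfolding growth_mp_def growth_mtp_def growth_tp_def growth_p_def
    by (meson order_refl less_imp_le)+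
  have fr_nn: "0 \<le> f_resid L1 L3 L4 L5 m t p" for t using nn by (simp add: f_resid_def)
  have eps: "\<forall>\<^sub>F \<epsilon> in at_right 0. (0::real) < \<epsilon>" by (simp add: eventually_at_right_less)
  {
    case base
    have "\<forall>\<^sub>F \<epsilon> in at_right 0.
        qr_factors L1 m p \<epsilon> (norm2 (col_block p A 1)) (col_block p A 1) (Qhat 1 \<epsilon>) (R 1 \<epsilon>)"
      using BCGS2 unfolding computed_BCGS2_def computed_local_qr_def by blast
    \<comment> \<open>The first block is a plain local factorization: its contract has no quadratic
      remainder, so the constant is 0, and \<open>f_resid\<close> is taken at t = 0.\<close>
    with eps have "\<forall>\<^sub>F \<epsilon> in at_right 0.
       Qhat 1 \<epsilon> \<in> carrier_mat m (1 * p) \<and> R 1 \<epsilon> \<in> carrier_mat (1 * p) (1 * p) \<and>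
       norm2 (leading_blocks p A 1 - Qhat 1 \<epsilon> * R 1 \<epsilon>)
         \<le> sqrt (real 1) * (\<epsilon> * f_resid L1 L3 L4 L5 m ((1 - 1) * p) p * norm2 (leading_blocks p A 1) + 0 * \<epsilon> ^ 2)"
    proof eventually_elim
      case (elim \<epsilon>)
      let ?B = "col_block p A 1"
      from elim have c: "Qhat 1 \<epsilon> \<in> carrier_mat m p" "R 1 \<epsilon> \<in> carrier_mat p p"
        and le: "norm2 (Qhat 1 \<epsilon> * R 1 \<epsilon> - ?B) \<le> \<epsilon> * L1 m p * norm2 ?B"
        by (auto simp: qr_factors_def)
      have "norm2 (?B - Qhat 1 \<epsilon> * R 1 \<epsilon>) \<le> \<epsilon> * L1 m p * norm2 ?B"
        using le c col_block_carrier[OF A, of p 1]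
        by (subst norm2_minus_commute[of _ m p]) auto
      also have "\<dots> \<le> \<epsilon> * f_resid L1 L3 L4 L5 m 0 p * norm2 ?B"
        using elim nn(1) nn(3)[of 0] nn(4,5) by (intro mult_right_mono mult_left_mono) (auto simp: f_resid_def)
      finally show ?case using c by (simp add: leading_blocks_1)
    qed
    then show ?case by blast
  next
    case (Suc k)
    let ?A = "\<lambda>k. leading_blocks p A k" and ?f = "\<lambda>t. f_resid L1 L3 L4 L5 m t p"
    let ?B = "col_block p A (Suc k)"
    from Suc obtain C where C0: "0 \<le> C" and IH: "\<forall>\<^sub>F \<epsilon> in at_right 0.
        Qhat k \<epsilon> \<in> carrier_mat m (k * p) \<and> R k \<epsilon> \<in> carrier_mat (k * p) (k * p) \<and>
        norm2 (?A k - Qhat k \<epsilon> * R k \<epsilon>)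
          \<le> sqrt k * (\<epsilon> * ?f ((k - 1) * p) * norm2 (?A k) + C * \<epsilon> ^ 2)"
      by auto
    have ks: "k \<in> {1..<s}" using Suc by auto
    with BCGS2 obtain Q' R' S' where
      CGS2: "computed_block_CGS2_step L1 L2 L3 L4 L5 m (k * p) p (Qhat k) (\<lambda>_. ?B) Q' R' S'" and
      QR: "\<forall>\<^sub>F \<epsilon> in at_right 0.
           Qhat (Suc k) \<epsilon> = hcat (Qhat k \<epsilon>) (Q' \<epsilon>) \<and>
           R (Suc k) \<epsilon> = four_block_mat (R k \<epsilon>) (S' \<epsilon>) (0\<^sub>m p (k * p)) (R' \<epsilon>)"
      unfolding computed_BCGS2_def by force
    have U: "\<forall>\<^sub>F \<epsilon> in at_right 0. Qhat k \<epsilon> \<in> carrier_mat m (k * p)"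
      using IH by eventually_elim auto
    have near_k: "near_left_orthogonal f1 m (k * p) p (Qhat k)" using near ks by blast
    note B = col_block_carrier[OF A, of p "Suc k"] and Ak = leading_blocks_carrier[OF A, of p k]
    obtain D where D0: "0 \<le> D" and D: "\<forall>\<^sub>F \<epsilon> in at_right 0.
        Q' \<epsilon> \<in> carrier_mat m p \<and> R' \<epsilon> \<in> carrier_mat p p \<and> S' \<epsilon> \<in> carrier_mat (k * p) p \<and>
        norm2 (?B - (Qhat k \<epsilon> * S' \<epsilon> + Q' \<epsilon> * R' \<epsilon>)) \<le> \<epsilon> * ?f (k * p) * norm2 ?B + D * \<epsilon> ^ 2"
      using computed_block_CGS2_step_residual[OF CGS2 U near_k B nn] by blast
    have "\<forall>\<^sub>F \<epsilon> in at_right 0.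
       Qhat (Suc k) \<epsilon> \<in> carrier_mat m (Suc k * p) \<and> R (Suc k) \<epsilon> \<in> carrier_mat (Suc k * p) (Suc k * p) \<and>
       norm2 (?A (Suc k) - Qhat (Suc k) \<epsilon> * R (Suc k) \<epsilon>)
         \<le> sqrt (Suc k) * (\<epsilon> * ?f ((Suc k - 1) * p) * norm2 (?A (Suc k)) + (C + D) * \<epsilon> ^ 2)"
      using eps IH QR D
    proof eventually_elim
      case (elim \<epsilon>)
      let ?Q = "Qhat k \<epsilon>" and ?R = "R k \<epsilon>"
      \<comment> \<open>The common bound: it dominates the new block's residual and, up to sqrt k,
        the old residual, since \<open>f_resid\<close> grows with t and both \<open>?A k\<close> and
        \<open>?B\<close> are blocks of \<open>?A (Suc k)\<close>.\<close>
      define e where "e = \<epsilon> * ?f (k * p) * norm2 (?A (Suc k)) + (C + D) * \<epsilon> ^ 2"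
      have c: "?Q \<in> carrier_mat m (k * p)" "Q' \<epsilon> \<in> carrier_mat m p" "?R \<in> carrier_mat (k * p) (k * p)"
        "S' \<epsilon> \<in> carrier_mat (k * p) p" "R' \<epsilon> \<in> carrier_mat p p"
        using elim by auto
      have Qc: "Qhat (Suc k) \<epsilon> \<in> carrier_mat m (Suc k * p)"
        using elim hcat_carrier[OF c(1,2)] by (simp add: add.commute)
      have Rc: "R (Suc k) \<epsilon> \<in> carrier_mat (Suc k * p) (Suc k * p)"
        using elim four_block_carrier_mat[OF c(3,5), of "S' \<epsilon>" "0\<^sub>m p (k * p)"]
        by (simp add: add.commute)
      have "?A (Suc k) - Qhat (Suc k) \<epsilon> * R (Suc k) \<epsilon>
          = hcat (?A k) ?B - hcat (?Q * ?R) (?Q * S' \<epsilon> + Q' \<epsilon> * R' \<epsilon>)"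
        using elim hcat_mult_upper[OF c] by (simp add: leading_blocks_Suc)
      also have "\<dots> = hcat (?A k - ?Q * ?R) (?B - (?Q * S' \<epsilon> + Q' \<epsilon> * R' \<epsilon>))"
        using c B Ak by (intro hcat_minus[of _ m "k * p" _ p]) auto
      finally have eq: "?A (Suc k) - Qhat (Suc k) \<epsilon> * R (Suc k) \<epsilon>
          = hcat (?A k - ?Q * ?R) (?B - (?Q * S' \<epsilon> + Q' \<epsilon> * R' \<epsilon>))" .
      have e0: "0 \<le> e" using elim fr_nn[of "k * p"] C0 D0 by (simp add: e_def)
      have left: "norm2 (?A k - ?Q * ?R) \<le> sqrt k * e"
      proof -
        have "?f ((k - 1) * p) \<le> ?f (k * p)"
          using growth mp by (intro f_resid_mono) (auto simp: mult_right_mono)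
        moreover have "norm2 (?A k) \<le> norm2 (?A (Suc k))"
          unfolding leading_blocks_Suc by (rule norm2_le_hcat[OF Ak B])
        ultimately have "\<epsilon> * ?f ((k - 1) * p) * norm2 (?A k) + C * \<epsilon> ^ 2 \<le> e"
          unfolding e_def using elim fr_nn C0 D0
          by (intro add_mono mult_mono mult_left_mono mult_right_mono mult_nonneg_nonneg) auto
        then have "sqrt k * (\<epsilon> * ?f ((k - 1) * p) * norm2 (?A k) + C * \<epsilon> ^ 2) \<le> sqrt k * e"
          by (intro mult_left_mono) auto
        then show ?thesis using elim by linarith
      qed
      have right: "norm2 (?B - (?Q * S' \<epsilon> + Q' \<epsilon> * R' \<epsilon>)) \<le> e"
      proof -
        have "norm2 ?B \<le> norm2 (?A (Suc k))"
          unfolding leading_blocks_Suc by (rule norm2_le_hcat[OF Ak B])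
        then have "\<epsilon> * ?f (k * p) * norm2 ?B + D * \<epsilon> ^ 2 \<le> e"
          unfolding e_def using elim fr_nn C0 D0
          by (intro add_mono mult_left_mono mult_right_mono mult_nonneg_nonneg) auto
        then show ?thesis using elim by linarith
      qed
      have "norm2 (?A (Suc k) - Qhat (Suc k) \<epsilon> * R (Suc k) \<epsilon>) ^ 2
          \<le> norm2 (?A k - ?Q * ?R) ^ 2 + norm2 (?B - (?Q * S' \<epsilon> + Q' \<epsilon> * R' \<epsilon>)) ^ 2"
        unfolding eq using c B Ak by (intro norm2_hcat_sq_le[of _ m "k * p" _ p]) auto
      also have "\<dots> \<le> (sqrt k * e) ^ 2 + e ^ 2"
        by (intro add_mono power_mono left right) auto
      also have "\<dots> = (sqrt (Suc k) * e) ^ 2"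
        by (simp add: power_mult_distrib algebra_simps)
      finally have "norm2 (?A (Suc k) - Qhat (Suc k) \<epsilon> * R (Suc k) \<epsilon>) \<le> sqrt (Suc k) * e"
        by (rule power2_le_imp_le) (use e0 in auto)
      then show ?case using Qc Rc by (simp add: e_def)
    qed
    moreover have "0 \<le> C + D" using C0 D0 by simp
    ultimately show ?case by blast
  }
qed

theorem theorem3p3:
  fixes m n p s :: nat
    and A :: "real mat"
    and L1 L3 :: "nat \<Rightarrow> nat \<Rightarrow> real"
    and L2 f1 :: "nat \<Rightarrow> nat \<Rightarrow> nat \<Rightarrow> real"
    and L4 L5 :: "nat \<Rightarrow> real"
    and Qhat R :: "nat \<Rightarrow> real \<Rightarrow> real mat"
  assumes "1 \<le> p" and "1 \<le> s" and "n = s * p" and "n \<le> m"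
    and "A \<in> carrier_mat m n" and "vec_space.rank m A = n"
    and "growth_mp L1" and "growth_mtp L2" and "growth_tp L3"
    and "growth_p L4" and "growth_p L5" and "growth_mtp f1"
    and "computed_BCGS2 L1 L2 L3 L4 L5 m p s A Qhat R"
    and "\<forall>k \<in> {1..<s}. near_left_orthogonal f1 m (k * p) p (Qhat k)"
  shows "(\<forall>k \<in> {1..s}.
            le_upto_eps2
              (\<lambda>\<epsilon>. norm2 (leading_blocks p A k - Qhat k \<epsilon> * R k \<epsilon>))
              (\<lambda>\<epsilon>. \<epsilon> * f2 L1 L3 L4 L5 m p k * norm2 (leading_blocks p A k))) \<and>
         le_upto_eps2
           (\<lambda>\<epsilon>. norm2 (A - Qhat s \<epsilon> * R s \<epsilon>))
           (\<lambda>\<epsilon>. \<epsilon> * f2 L1 L3 L4 L5 m p s * norm2 A)"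
proof -
  \<comment> \<open>The growth conditions speak only about positive dimensions; here 1 \<le> s p = n
    \<le> m.\<close>
  have "1 \<le> m" using assms(1-4) by (metis le_trans mult_le_mono nat_mult_1)
  have bound: "le_upto_eps2
      (\<lambda>\<epsilon>. norm2 (leading_blocks p A k - Qhat k \<epsilon> * R k \<epsilon>))
      (\<lambda>\<epsilon>. \<epsilon> * f2 L1 L3 L4 L5 m p k * norm2 (leading_blocks p A k))"
    if k: "1 \<le> k" "k \<le> s" for k
  proof -
    obtain C where "\<forall>\<^sub>F \<epsilon> in at_right 0. norm2 (leading_blocks p A k - Qhat k \<epsilon> * R k \<epsilon>)
       \<le> sqrt k * (\<epsilon> * f_resid L1 L3 L4 L5 m ((k - 1) * p) p * norm2 (leading_blocks p A k) + C * \<epsilon> ^ 2)"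
      using BCGS2_residual[OF assms(13,14,5) \<open>1 \<le> m\<close> assms(1,7-11) k]
      by (auto simp: eventually_conj_iff)
    \<comment> \<open>The factor sqrt k turns \<open>f_resid\<close> into \<open>f2\<close> and is
      absorbed into the constant of the quadratic term.\<close>
    then have "\<forall>\<^sub>F \<epsilon> in at_right 0. norm2 (leading_blocks p A k - Qhat k \<epsilon> * R k \<epsilon>)
       \<le> \<epsilon> * f2 L1 L3 L4 L5 m p k * norm2 (leading_blocks p A k) + (sqrt k * C) * \<epsilon> ^ 2"
      by eventually_elim (simp add: f2_def algebra_simps)
    then show ?thesis by (rule le_upto_eps2I)
  qed
  moreover have "leading_blocks p A s = A" using assms(3,5) leading_blocks_all by blast
  ultimately show ?thesis using bound[OF assms(2) order_refl] by auto
qed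

end
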